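(* Let $F\in\mathcal{F}[-\pi,\pi]$ and let $F$ be continuous (with respect to the Hausdorff metric) at $x\in(-\pi,\pi)$. Then $$\lim_{n\to\infty}\mathrm{haus}\big(\mathscr{S}_nF(x),F(x)\big)=0,$$ where $\mathscr{S}_nF$ is the $n$-th term of the metric Fourier series of $F$. If $F$ is continuous in a closed interval $I\subset(-\pi,\pi)$ (that is, $F$ is continuous at every point of $I$), then the convergence is uniform in $I$.
   Context: Fix $d\ge1$ and a norm $|\cdot|$ on $\mathbb{R}^d$. $\mathrm{K}(\mathbb{R}^d)$ is the collection of non-empty compact subsets of $\mathbb{R}^d$. For non-empty $A,B\subset\mathbb{R}^d$, $\mathrm{haus}(A,B)=\max\{\sup_{a\in A}\mathrm{dist}(a,B),\sup_{b\in B}\mathrm{dist}(b,A)\}$ with $\mathrm{dist}(c,D)=\inf_{d\in D}|c-d|$. The total variation of $F:[a,b]\to\mathrm{K}(\mathbb{R}^d)$ is $V_a^b(F)=\sup\sum_{i=1}^n\mathrm{haus}(F(x_i),F(x_{i-1}))$ over all partitions $a=x_0<\dots<x_n=b$. $\mathcal{F}[a,b]$ is the set of all $F:[a,b]\to\mathrm{K}(\mathbb{R}^d)$ with $V_a^b(F)<\infty$ whose graph $\{(x,y): x\in[a,b],\ y\in F(x)\}$ is compact. For $A,B\in\mathrm{K}(\mathbb{R}^d)$, the set of metric pairs is $\Pi(A,B)=\{(a,b)\in A\times B:\ |a-b|=\mathrm{dist}(b,A)\ \text{or}\ |a-b|=\mathrm{dist}(a,B)\}$. A metric chain of $A_0,\dots,A_n$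 is a tuple $(a_0,\dots,a_n)$ with $(a_i,a_{i+1})\in\Pi(A_i,A_{i+1})$, $i=0,\dots,n-1$; $\mathrm{CH}(A_0,\dots,A_n)$ is the set of all metric chains. For $k:[a,b]\to\mathbb{R}$ and a partition $\chi=\{a=x_0<\dots<x_n=b\}$ with norm $|\chi|=\max_i(x_{i+1}-x_i)$, the weighted metric Riemann sum is $(\mathcal{M}_k)S_\chi F=\{\sum_{i=0}^{n-1}(x_{i+1}-x_i)k(x_i)y_i:\ (y_0,\dots,y_{n-1})\in\mathrm{CH}(F(x_0),\dots,F(x_{n-1}))\}$. The weighted metric integral $(\mathcal{M}_k)\int_a^bk(x)F(x)dx$ is the set of all $y\in\mathbb{R}^d$ for which there are partitions $\chi_n$ with $|\chi_n|\to0$ and points $y_n\in(\mathcal{M}_k)S_{\chi_n}F$ with $y_n\to y$. The Dirichlet kernel is $D_n(x)=\frac12+\sum_{k=1}^n\cos kx$, and $\partial_{n,x}(t)=D_n(x-t)$. The metric Fourier series of $F:[-\pi,\pi]\to\mathrm{K}(\mathbb{R}^d)$ is the sequence of set-valued functions $\mathscr{S}_nF(x)=\frac1\pi(\mathcal{M}_{\partial_{n,x}})\int_{-\pi}^{\pi}\partial_{n,x}(t)F(t)dt$, $x\in[-\pi,\pi]$, $n\in\mathbb{N}$. *)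

theory Defs
  imports "HOL-Analysis.Analysis"
begin

(* The norm on R^d is an arbitrary function N, not the Euclidean norm of the type.
   Compactness and convergence of points refer to the topology of the type; all norms on R^d
   induce that topology. *)
definition is_norm :: "(real ^ 'd \<Rightarrow> real) \<Rightarrow> bool" where
  "is_norm N \<longleftrightarrow>
     (\<forall>x. 0 \<le> N x) \<and>
     (\<forall>x. N x = 0 \<longleftrightarrow> x = 0) \<and>
     (\<forall>c x. N (c *\<^sub>R x) = \<bar>c\<bar> * N x) \<and>
     (\<forall>x y. N (x + y) \<le> N x + N y)"

(* Distances take values in [0,\<infinity>], so that infima and suprema carry their usual meaning for
   arbitrary sets: the distance to {} is \<infinity>, and the Hausdorff distance of two nonempty sets,
   exactly one of which is bounded, is \<infinity>. *)
definition dist_set :: "(real ^ 'd \<Rightarrow> real) \<Rightarrow> real ^ 'd \<Rightarrow> (real ^ 'd) set \<Rightarrow> ennreal" where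
  "dist_set N c D = (INF d\<in>D. ennreal (N (c - d)))"

definition haus :: "(real ^ 'd \<Rightarrow> real) \<Rightarrow> (real ^ 'd) set \<Rightarrow> (real ^ 'd) set \<Rightarrow> ennreal" where
  "haus N A B = max (SUP a\<in>A. dist_set N a B) (SUP b\<in>B. dist_set N b A)"

definition haus_continuous_at ::
  "(real ^ 'd \<Rightarrow> real) \<Rightarrow> real set \<Rightarrow> (real \<Rightarrow> (real ^ 'd) set) \<Rightarrow> real \<Rightarrow> bool" where
  "haus_continuous_at N S F x \<longleftrightarrow> ((\<lambda>t. haus N (F t) (F x)) \<longlongrightarrow> 0) (at x within S)"

definition partitions :: "real \<Rightarrow> real \<Rightarrow> real list set" where
  "partitions a b = {xs. xs \<noteq> [] \<and> hd xs = a \<and> last xs = b \<and> sorted_wrt (<) xs}"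

definition mesh :: "real list \<Rightarrow> real" where
  "mesh xs = Max ((\<lambda>i. xs ! Suc i - xs ! i) ` {..<length xs - 1})"

definition total_variation ::
  "(real ^ 'd \<Rightarrow> real) \<Rightarrow> real \<Rightarrow> real \<Rightarrow> (real \<Rightarrow> (real ^ 'd) set) \<Rightarrow> ennreal" where
  "total_variation N a b F =
     (SUP xs\<in>partitions a b. \<Sum>i = 1..length xs - 1. haus N (F (xs ! i)) (F (xs ! (i - 1))))"

(* The class \<F>[a,b]; values of F outside [a,b] are irrelevant. *)
definition BV_compact_graph ::
  "(real ^ 'd \<Rightarrow> real) \<Rightarrow> real \<Rightarrow> real \<Rightarrow> (real \<Rightarrow> (real ^ 'd) set) set" where
  "BV_compact_graph N a b =
     {F. (\<forall>x\<in>{a..b}. F x \<noteq> {} \<and> compact (F x)) \<and>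
         total_variation N a b F < \<infinity> \<and>
         compact {(x, y). x \<in> {a..b} \<and> y \<in> F x}}"

definition metric_pairs ::
  "(real ^ 'd \<Rightarrow> real) \<Rightarrow> (real ^ 'd) set \<Rightarrow> (real ^ 'd) set \<Rightarrow> ((real ^ 'd) \<times> (real ^ 'd)) set" where
  "metric_pairs N A B =
     {(a, b). a \<in> A \<and> b \<in> B \<and>
        (ennreal (N (a - b)) = dist_set N b A \<or> ennreal (N (a - b)) = dist_set N a B)}"

(* Membership in the sets is stated separately: it follows from the pair condition except for
   chains of a single set, where CH(A) = A. *)
definition metric_chains ::
  "(real ^ 'd \<Rightarrow> real) \<Rightarrow> (real ^ 'd) set list \<Rightarrow> (real ^ 'd) list set" where
  "metric_chains N As =
     {ys. length ys = length As \<and>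
          (\<forall>i < length As. ys ! i \<in> As ! i) \<and>
          (\<forall>i. Suc i < length As \<longrightarrow> (ys ! i, ys ! Suc i) \<in> metric_pairs N (As ! i) (As ! Suc i))}"

definition weighted_riemann_sum ::
  "(real ^ 'd \<Rightarrow> real) \<Rightarrow> (real \<Rightarrow> real) \<Rightarrow> real list \<Rightarrow> (real \<Rightarrow> (real ^ 'd) set) \<Rightarrow> (real ^ 'd) set"
  where
  "weighted_riemann_sum N k xs F =
     {(\<Sum>i < length xs - 1. ((xs ! Suc i - xs ! i) * k (xs ! i)) *\<^sub>R ys ! i) | ys.
        ys \<in> metric_chains N (map F (butlast xs))}"

definition weighted_metric_integral ::
  "(real ^ 'd \<Rightarrow> real) \<Rightarrow> (real \<Rightarrow> real) \<Rightarrow> real \<Rightarrow> real \<Rightarrow> (real \<Rightarrow> (real ^ 'd) set) \<Rightarrow> (real ^ 'd) set"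
  where
  "weighted_metric_integral N k a b F =
     {y. \<exists>\<xi> s. (\<forall>n. \<xi> n \<in> partitions a b) \<and> (\<lambda>n. mesh (\<xi> n)) \<longlonglongrightarrow> 0 \<and>
               (\<forall>n. s n \<in> weighted_riemann_sum N k (\<xi> n) F) \<and> s \<longlonglongrightarrow> y}"

definition dirichlet_kernel :: "nat \<Rightarrow> real \<Rightarrow> real" where
  "dirichlet_kernel n x = 1 / 2 + (\<Sum>k = 1..n. cos (real k * x))"

definition metric_fourier ::
  "(real ^ 'd \<Rightarrow> real) \<Rightarrow> (real \<Rightarrow> (real ^ 'd) set) \<Rightarrow> nat \<Rightarrow> real \<Rightarrow> (real ^ 'd) set" where
  "metric_fourier N F n x =
     (\<lambda>y. (1 / pi) *\<^sub>R y) ` weighted_metric_integral N (\<lambda>t. dirichlet_kernel n (x - t)) (- pi) pi F"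

end

theory Submission
  imports Defs
begin

text \<open>Put \<open>E t = \<integral> D\<^sub>n (x - s) ds\<close> over \<open>[-\<pi>, t]\<close>. For a fine partition and a metric chain \<open>y\<close>
  the Riemann sum is close to \<open>\<Sum> (E x\<^sub>i\<^sub>+\<^sub>1 - E x\<^sub>i) y\<^sub>i\<close>, and summation by parts shows that it differs
  from \<open>\<pi> y\<^sub>j\<close>, where \<open>x\<^sub>j \<le> x < x\<^sub>j\<^sub>+\<^sub>1\<close>, by a sum of increments \<open>y\<^sub>i - y\<^sub>i\<^sub>-\<^sub>1\<close> weighted by
  \<open>E x\<^sub>i - \<pi> [x\<^sub>i > x]\<close>. The weights are bounded, and tend to \<open>0\<close> uniformly away from \<open>x\<close>; the
  increments are controlled by the variation of \<open>F\<close>, which is small near a point of continuity. So a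
  Riemann sum divided by \<open>\<pi>\<close> is close to the value near \<open>x\<close> of its chain. This bounds one half of the
  Hausdorff distance; for the other half, every point of \<open>F x\<close> lies on some metric chain. All
  bounds are uniform near \<open>x\<close>, and compactness gives uniformity on intervals.\<close>

section \<open>The integrated Dirichlet kernel\<close>

text \<open>The odd antiderivative of \<open>dirichlet_kernel n\<close>. As n grows it approaches
  \<pi>/2 on (0, 2\<pi>), hence -\<pi>/2 on (-2\<pi>, 0); this jump of size \<pi> at 0 produces the
  factor \<pi> in front of the value of a chain near x.\<close>

definition dirichlet_primitive :: "nat \<Rightarrow> real \<Rightarrow> real" where
  "dirichlet_primitive n u = u / 2 + (\<Sum>k = 1..n. sin (real k * u) / real k)"

lemma has_real_derivative_dirichlet_primitive:
  "(dirichlet_primitive n has_real_derivative dirichlet_kernel n u) (at u)"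
  unfolding dirichlet_primitive_def dirichlet_kernel_def
  by (auto intro!: derivative_eq_intros sum.cong)

lemma dirichlet_primitive_minus: "dirichlet_primitive n (- u) = - dirichlet_primitive n u"
  by (simp add: dirichlet_primitive_def sum_negf)

text \<open>The sine sum is odd and 2\<pi>-periodic, so the constant comes from the linear term
  alone. This transfers bounds on (0, \<pi>] to the rest of the period.\<close>

lemma dirichlet_primitive_reflect:
  "dirichlet_primitive n (2 * pi - u) = pi - dirichlet_primitive n u"
proof -
  have "sin (real k * (2 * pi - u)) = - sin (real k * u)" for k
  proof -
    have "sin (real k * (2 * pi - u)) = sin (2 * pi * real k - real k * u)"
      by (simp add: algebra_simps)
    also have "\<dots> = - sin (real k * u)"
      using sin_2npi[of k] cos_2npi[of k] by (simp add: sin_diff mult_ac)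
    finally show ?thesis .
  qed
  then show ?thesis
    by (simp add: dirichlet_primitive_def sum_negf field_simps)
qed

lemma dirichlet_primitive_pi: "dirichlet_primitive n pi = pi / 2"
  using dirichlet_primitive_reflect[of n pi] by simp

lemma dirichlet_kernel_closed_form:
  "dirichlet_kernel n u * (2 * sin (u / 2)) = sin ((real n + 1 / 2) * u)"
proof (induction n)
  case 0
  then show ?case by (simp add: dirichlet_kernel_def)
next
  case (Suc n)
  have "sin ((real (Suc n) + 1 / 2) * u) - sin ((real n + 1 / 2) * u) =
      2 * sin (u / 2) * cos (real (Suc n) * u)"
  proof -
    have "((real (Suc n) + 1 / 2) * u - (real n + 1 / 2) * u) / 2 = u / 2"
      "((real (Suc n) + 1 / 2) * u + (real n + 1 / 2) * u) / 2 = real (Suc n) * u"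
      by (simp_all add: field_simps)
    then show ?thesis by (simp only: sin_diff_sin)
  qed
  with Suc show ?case
    by (simp add: dirichlet_kernel_def algebra_simps)
qed

text \<open>Each cosine contributes its frequency. The growth of the constant with n is harmless,
  because n stays fixed while the mesh of the partitions tends to 0.\<close>

lemma dirichlet_kernel_lipschitz:
  "\<bar>dirichlet_kernel n s - dirichlet_kernel n t\<bar> \<le> (\<Sum>k = 1..n. real k) * \<bar>s - t\<bar>"
proof -
  have "\<bar>cos (real k * s) - cos (real k * t)\<bar> \<le> real k * \<bar>s - t\<bar>" for k
  proof -
    have "\<bar>cos (real k * s) - cos (real k * t)\<bar> \<le> 1 * \<bar>real k * s - real k * t\<bar>"
      using field_differentiable_bound[of UNIV cos "\<lambda>x. - sin x" 1 "real k * s" "real k * t"]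
      by (auto intro!: derivative_eq_intros simp: norm_minus_commute)
    also have "\<dots> = real k * \<bar>s - t\<bar>"
      by (simp add: abs_mult flip: right_diff_distrib)
    finally show ?thesis .
  qed
  then have "(\<Sum>k = 1..n. \<bar>cos (real k * s) - cos (real k * t)\<bar>) \<le> (\<Sum>k = 1..n. real k * \<bar>s - t\<bar>)"
    by (intro sum_mono)
  then show ?thesis
    unfolding dirichlet_kernel_def
    by (simp only: add_diff_cancel_left sum_distrib_right flip: sum_subtractf)
       (rule order_trans[OF sum_abs])
qed

lemma abs_dirichlet_kernel_le: "\<bar>dirichlet_kernel n u\<bar> \<le> real n + 1 / 2"
proof -
  have "\<bar>\<Sum>k = 1..n. cos (real k * u)\<bar> \<le> (\<Sum>k = 1..n. \<bar>cos (real k * u)\<bar>)" by simp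
  also have "\<dots> \<le> (\<Sum>k = 1..n. 1)" by (intro sum_mono) simp
  finally show ?thesis by (simp add: dirichlet_kernel_def)
qed

text \<open>Mean value theorem followed by the Lipschitz bound. The kernel is evaluated at v because
  v will be x minus the left node of a partition interval, the node used by the Riemann sum; the
  quadratic errors then sum to a multiple of the mesh.\<close>

lemma dirichlet_primitive_taylor:
  "\<bar>dirichlet_primitive n v - dirichlet_primitive n u - (v - u) * dirichlet_kernel n v\<bar>
    \<le> (\<Sum>k = 1..n. real k) * (v - u)\<^sup>2"
proof -
  let ?L = "\<Sum>k = 1..n. real k"
  have "\<exists>w. \<bar>w - v\<bar> \<le> \<bar>v - u\<bar> \<and>
      dirichlet_primitive n v - dirichlet_primitive n u = (v - u) * dirichlet_kernel n w"
  proof (cases u v rule: linorder_cases)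
    case less
    from MVT2[OF less has_real_derivative_dirichlet_primitive[of n]]
    obtain z where "u < z" "z < v"
      "dirichlet_primitive n v - dirichlet_primitive n u = (v - u) * dirichlet_kernel n z" by auto
    then show ?thesis by (intro exI[of _ z]) auto
  next
    case greater
    from MVT2[OF greater has_real_derivative_dirichlet_primitive[of n]]
    obtain z where "z > v" "z < u"
      "dirichlet_primitive n u - dirichlet_primitive n v = (u - v) * dirichlet_kernel n z" by auto
    then show ?thesis by (intro exI[of _ z]) (auto simp: algebra_simps)
  qed auto
  then obtain w where w: "\<bar>w - v\<bar> \<le> \<bar>v - u\<bar>"
    "dirichlet_primitive n v - dirichlet_primitive n u = (v - u) * dirichlet_kernel n w" by blast
  have "\<bar>dirichlet_primitive n v - dirichlet_primitive n u - (v - u) * dirichlet_kernel n v\<bar>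
      = \<bar>v - u\<bar> * \<bar>dirichlet_kernel n w - dirichlet_kernel n v\<bar>"
    unfolding w by (simp flip: right_diff_distrib abs_mult)
  also have "\<dots> \<le> \<bar>v - u\<bar> * (?L * \<bar>v - u\<bar>)"
    by (intro mult_left_mono order_trans[OF dirichlet_kernel_lipschitz] w)
       (auto intro: w sum_nonneg)
  finally show ?thesis by (simp add: power2_eq_square mult_ac abs_mult_self_eq)
qed

text \<open>On \<open>(0, 2\<pi>)\<close> the function
  \<open>dirichlet_primitive n u + cos ((n + 1/2) u) / ((2n + 1) sin (u/2))\<close> has a derivative dominated
  by that of \<open>- cot (u/2) / (2n + 1)\<close>.\<close>

lemma dirichlet_primitive_approx_left:
  assumes "0 < u" "u \<le> pi"
  shows "\<bar>dirichlet_primitive n u - pi / 2\<bar> \<le> 2 / ((2 * real n + 1) * sin (u / 2))"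
proof -
  define m where "m = 2 * real n + 1"
  have m: "m > 0" "real n + 1 / 2 = m / 2" by (auto simp: m_def)
  define c where "c t = cos (t / 2) / (m * sin (t / 2))" for t
  \<comment> \<open>The added term comes from integrating the closed form by parts once:
    differentiating its numerator cancels the kernel, and only the derivative of 1 / sin
    remains.\<close>
  define g where "g t = dirichlet_primitive n t + cos (m / 2 * t) / (m * sin (t / 2))" for t
  define g' where "g' t = - cos (m / 2 * t) * cos (t / 2) / (2 * m * (sin (t / 2))\<^sup>2)" for t
  define c' where "c' t = - 1 / (2 * m * (sin (t / 2))\<^sup>2)" for t
  have pos: "sin (t / 2) > 0" if "u \<le> t" "t \<le> pi" for t
    using that assms by (intro sin_gt_zero) auto
  have dg: "(g has_real_derivative g' t) (at t)" if "u \<le> t" "t \<le> pi" for t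
  proof -
    have "(g has_real_derivative dirichlet_kernel n t +
        (- sin (m / 2 * t) * (m / 2) * (m * sin (t / 2)) - cos (m / 2 * t) * (m * (cos (t / 2) * (1 / 2))))
          / ((m * sin (t / 2)) * (m * sin (t / 2)))) (at t)"
      unfolding g_def using pos[OF that] m(1)
      by (auto intro!: derivative_eq_intros has_real_derivative_dirichlet_primitive)
    moreover have "dirichlet_kernel n t = sin (m / 2 * t) / (2 * sin (t / 2))"
      using dirichlet_kernel_closed_form[of n t] pos[OF that] m by (simp add: field_simps)
    ultimately show ?thesis
      using pos[OF that] m(1) unfolding g'_def
      by (simp add: divide_simps power2_eq_square mult_ac)
  qed
  have eq: "- S * (1 / 2) * (m * S) - C * (m * (C * (1 / 2))) = - (m / 2) * (S\<^sup>2 + C\<^sup>2)"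
    for S C :: real by (simp add: algebra_simps power2_eq_square)
  have dc: "(c has_real_derivative c' t) (at t)" if "u \<le> t" "t \<le> pi" for t
  proof -
    have "(c has_real_derivative
        (- sin (t / 2) * (1 / 2) * (m * sin (t / 2)) - cos (t / 2) * (m * (cos (t / 2) * (1 / 2))))
          / ((m * sin (t / 2)) * (m * sin (t / 2)))) (at t)"
      unfolding c_def using pos[OF that] m by (auto intro!: derivative_eq_intros)
    also have "- sin (t / 2) * (1 / 2) * (m * sin (t / 2)) - cos (t / 2) * (m * (cos (t / 2) * (1 / 2)))
        = - (m / 2) * ((sin (t / 2))\<^sup>2 + (cos (t / 2))\<^sup>2)"
      by (rule eq)
    also have "(sin (t / 2))\<^sup>2 + (cos (t / 2))\<^sup>2 = 1" by simp
    finally show ?thesis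
      using pos[OF that] m unfolding c'_def by (simp add: divide_simps power2_eq_square mult_ac)
  qed
  have gc: "\<bar>g' t\<bar> \<le> - c' t" if "u \<le> t" "t \<le> pi" for t
  proof -
    have "\<bar>cos (m / 2 * t) * cos (t / 2)\<bar> \<le> 1 * 1"
      unfolding abs_mult by (intro mult_mono) auto
    then show ?thesis
      using m unfolding g'_def c'_def by (simp add: abs_mult divide_right_mono)
  qed
  have gpi: "g pi = pi / 2"
  proof -
    have "cos (m / 2 * pi) = 0"
      using cos_pi_eq_zero[of n] by (simp add: m_def field_simps)
    then show ?thesis by (simp add: g_def dirichlet_primitive_pi)
  qed
  have cpi: "c pi = 0" by (simp add: c_def)
  \<comment> \<open>Since \<open>g'\<close> is dominated by \<open>- c'\<close>, g - c increases and
    g + c decreases. Both equal \<pi>/2 at \<pi>, which encloses g u between \<pi>/2 - c u and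
    \<pi>/2 + c u.\<close>
  have "(\<lambda>t. g t - c t) u \<le> (\<lambda>t. g t - c t) pi"
    by (rule DERIV_nonneg_imp_nondecreasing[OF assms(2)])
       (use gc in \<open>force intro!: derivative_eq_intros dg dc\<close>)
  moreover have "(\<lambda>t. g t + c t) u \<ge> (\<lambda>t. g t + c t) pi"
    by (rule DERIV_nonpos_imp_nonincreasing[OF assms(2)])
       (use gc in \<open>force intro!: derivative_eq_intros dg dc\<close>)
  ultimately have "\<bar>g u - pi / 2\<bar> \<le> c u" using gpi cpi by simp
  moreover have "dirichlet_primitive n u = g u - cos (m / 2 * u) / (m * sin (u / 2))"
    by (simp add: g_def)
  ultimately have "\<bar>dirichlet_primitive n u - pi / 2\<bar> \<le> c u + \<bar>cos (m / 2 * u) / (m * sin (u / 2))\<bar>"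
    by linarith
  also have "\<dots> \<le> 1 / (m * sin (u / 2)) + 1 / (m * sin (u / 2))"
    using pos[of u] assms m unfolding c_def
    by (intro add_mono) (auto simp: abs_mult divide_right_mono)
  finally show ?thesis by (simp add: m_def mult_ac)
qed

lemma dirichlet_primitive_approx:
  assumes "0 < u" "u < 2 * pi"
  shows "\<bar>dirichlet_primitive n u - pi / 2\<bar> \<le> 2 / ((2 * real n + 1) * sin (u / 2))"
proof (cases "u \<le> pi")
  case False
  have "sin ((2 * pi - u) / 2) = sin (u / 2)"
    by (simp add: diff_divide_distrib)
  then show ?thesis
    using dirichlet_primitive_approx_left[of "2 * pi - u" n] assms False
    by (simp add: dirichlet_primitive_reflect abs_minus_commute)
qed (use assms dirichlet_primitive_approx_left in auto)

section \<open>Bounds uniform in n\<close>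

lemma sin_ge_half:
  fixes x :: real
  assumes "0 \<le> x" "x \<le> pi / 2"
  shows "x / 2 \<le> sin x"
\<comment> \<open>Up to \<pi>/3 the derivative cos t - 1/2 of sin t - t/2 is nonnegative. Beyond,
  sin x is at least sqrt 3 / 2 > 0.8, whereas x / 2 \<le> \<pi>/4 < 0.8.\<close>
proof (cases "x \<le> pi / 3")
  case True
  have "(\<lambda>t. sin t - t / 2) 0 \<le> (\<lambda>t. sin t - t / 2) x"
  proof (rule DERIV_nonneg_imp_nondecreasing[OF assms(1)])
    fix t :: real assume t: "0 \<le> t" "t \<le> x"
    have "cos (pi / 3) \<le> cos t"
      using t True by (intro cos_monotone_0_pi_le) auto
    then show "\<exists>y. ((\<lambda>t. sin t - t / 2) has_real_derivative y) (at t) \<and> 0 \<le> y"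
      by (intro exI[of _ "cos t - 1 / 2"]) (auto intro!: derivative_eq_intros simp: cos_60)
  qed
  then show ?thesis by simp
next
  case False
  have "sin (pi / 3) \<le> sin x"
    using assms False by (intro sin_monotone_2pi_le) auto
  moreover have "sqrt 3 \<ge> 1.7" by (rule real_le_rsqrt) (simp add: power2_eq_square)
  ultimately show ?thesis using assms pi_less_4 pi_approx by (simp add: sin_60)
qed

text \<open>Where (2n + 1) sin (u/2) \<ge> 1, the approximation by \<pi>/2 already gives a bound.
  Closer to 0, u is of order 1/n, and it suffices to bound each term of the sine sum by u. The bound
  4 on [0, \<pi>] becomes 4 + \<pi> < 8 by reflection.\<close>

lemma abs_dirichlet_primitive_le:
  assumes "\<bar>u\<bar> \<le> 2 * pi"
  shows "\<bar>dirichlet_primitive n u\<bar> \<le> 8"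
proof -
  have *: "\<bar>dirichlet_primitive n u\<bar> \<le> 4" if u: "0 \<le> u" "u \<le> pi" for u
  proof (cases "(2 * real n + 1) * sin (u / 2) \<ge> 1")
    case True
    then have "u \<noteq> 0" by auto
    then have "\<bar>dirichlet_primitive n u - pi / 2\<bar> \<le> 2 / ((2 * real n + 1) * sin (u / 2))"
      using dirichlet_primitive_approx_left[of u n] u by auto
    also have "\<dots> \<le> 2 / 1" using True by (intro divide_left_mono) auto
    finally show ?thesis using pi_less_4 pi_gt_zero unfolding abs_le_iff by linarith
  next
    case False
    have "\<bar>sin (real k * u) / real k\<bar> \<le> u" if "k \<in> {1..n}" for k
      using abs_sin_x_le_abs_x[of "real k * u"] that u by (simp add: field_simps abs_mult)
    then have "(\<Sum>k = 1..n. \<bar>sin (real k * u) / real k\<bar>) \<le> real (card {1..n}) * u"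
      by (rule sum_bounded_above)
    then have "\<bar>dirichlet_primitive n u\<bar> \<le> u / 2 + real n * u"
      unfolding dirichlet_primitive_def using u sum_abs[of "\<lambda>k. sin (real k * u) / real k" "{1..n}"]
      by (simp del: sum_abs)
    also have "\<dots> = (2 * real n + 1) * (2 * (u / 2 / 2))" by (simp add: field_simps)
    also have "\<dots> \<le> (2 * real n + 1) * (2 * sin (u / 2))"
      using sin_ge_half[of "u / 2"] u by (intro mult_left_mono) auto
    also have "\<dots> \<le> 2" using False by simp
    finally show ?thesis by simp
  qed
  have **: "\<bar>dirichlet_primitive n u\<bar> \<le> 8" if u: "0 \<le> u" "u \<le> 2 * pi" for u
  proof (cases "u \<le> pi")
    case False
    then have "\<bar>dirichlet_primitive n (2 * pi - u)\<bar> \<le> 4" using u by (intro *) auto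
    then show ?thesis
      using pi_less_4 pi_gt_zero unfolding dirichlet_primitive_reflect abs_le_iff by linarith
  qed (use *[of u] u in auto)
  show ?thesis
    using **[of u] **[of "- u"] assms by (cases "0 \<le> u") (auto simp: dirichlet_primitive_minus)
qed

text \<open>With \<open>E\<close> as in the overview this is \<open>E t - \<pi> [t > x]\<close>: the
  two primitives give the integral of the kernel over [-\<pi>, t], and for x in (-\<pi>, \<pi>) and
  t \<noteq> x the subtracted step is its limit.\<close>

definition step_error :: "nat \<Rightarrow> real \<Rightarrow> real \<Rightarrow> real" where
  "step_error n x t = dirichlet_primitive n (x + pi) - dirichlet_primitive n (x - t)
     - (if x < t then pi else 0)"

text \<open>The kernel has integral \<pi> over a full period, exactly the height of the step. This
  removes both boundary terms from the summation by parts.\<close>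

lemma step_error_ends:
  assumes "x \<in> {- pi<..<pi}"
  shows "step_error n x (- pi) = 0" "step_error n x pi = 0"
  using assms dirichlet_primitive_reflect[of n "x + pi"] dirichlet_primitive_minus[of n "x - pi"]
  by (auto simp: step_error_def)

lemma abs_step_error_le:
  assumes "x \<in> {- pi<..<pi}" "t \<in> {- pi..pi}"
  shows "\<bar>step_error n x t\<bar> \<le> 20"
proof -
  \<comment> \<open>The constant 20 covers two primitives bounded by 8 and a step of height \<pi> <
    4.\<close>
  have "\<bar>dirichlet_primitive n (x + pi)\<bar> \<le> 8" "\<bar>dirichlet_primitive n (x - t)\<bar> \<le> 8"
    using assms by (auto intro!: abs_dirichlet_primitive_le)
  then show ?thesis
    using pi_less_4 pi_gt_zero unfolding step_error_def abs_le_iff by (cases "x < t"; simp only: if_True if_False; linarith)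
qed

text \<open>On [\<delta>, 2\<pi> - \<delta>] the value sin (u/2) is smallest at the ends.\<close>

lemma dirichlet_primitive_approx_uniform:
  assumes "0 < \<delta>" "\<delta> \<le> u" "u \<le> 2 * pi - \<delta>"
  shows "\<bar>dirichlet_primitive n u - pi / 2\<bar> \<le> 2 / ((2 * real n + 1) * sin (\<delta> / 2))"
proof -
  have "sin (\<delta> / 2) \<le> sin (u / 2)"
  proof (cases "u \<le> pi")
    case False
    have "sin (\<delta> / 2) \<le> sin ((2 * pi - u) / 2)"
      using assms False by (intro sin_monotone_2pi_le) auto
    then show ?thesis by (simp add: diff_divide_distrib)
  qed (use assms in \<open>intro sin_monotone_2pi_le; auto\<close>)
  moreover have "0 < sin (\<delta> / 2)" using assms by (intro sin_gt_zero) auto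
  ultimately have "2 / ((2 * real n + 1) * sin (u / 2)) \<le> 2 / ((2 * real n + 1) * sin (\<delta> / 2))"
    by (intro divide_left_mono mult_left_mono mult_pos_pos) auto
  then show ?thesis
    using dirichlet_primitive_approx[of u n] assms by linarith
qed

text \<open>Both x + \<pi> and the distance of x and t lie in [\<delta>, 2\<pi> - \<delta>], so each
  primitive is close to \<pi>/2 up to sign. For t < x the two halves cancel; for t > x they add up
  to the height of the step.\<close>

lemma abs_step_error_away:
  assumes "0 < \<delta>" "x \<in> {- pi + \<delta>..pi - \<delta>}" "t \<in> {- pi..pi}" "\<delta> \<le> \<bar>x - t\<bar>"
  shows "\<bar>step_error n x t\<bar> \<le> 4 / ((2 * real n + 1) * sin (\<delta> / 2))"
proof -
  let ?b = "2 / ((2 * real n + 1) * sin (\<delta> / 2))"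
  have "\<bar>dirichlet_primitive n (x + pi) - pi / 2\<bar> \<le> ?b"
    using assms by (intro dirichlet_primitive_approx_uniform) auto
  moreover have "\<bar>dirichlet_primitive n \<bar>x - t\<bar> - pi / 2\<bar> \<le> ?b"
    using assms by (intro dirichlet_primitive_approx_uniform) auto
  moreover have "dirichlet_primitive n (x - t) = - dirichlet_primitive n \<bar>x - t\<bar>" if "x < t"
    using that dirichlet_primitive_minus[of n "x - t"] by simp
  moreover have "4 / ((2 * real n + 1) * sin (\<delta> / 2)) = ?b + ?b" by simp
  ultimately show ?thesis
    using assms unfolding step_error_def by (cases "x < t") (simp_all add: abs_if split: if_splits)
qed

section \<open>Partitions\<close>

text \<open>Moves the differences from the weights onto the chain, whose increments are controlled
  by Hausdorff distances.\<close>

lemma abel_summation: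
  fixes y :: "nat \<Rightarrow> 'a::real_vector"
  shows "(\<Sum>i<Suc q. (g (Suc i) - g i) *\<^sub>R y i) =
    g (Suc q) *\<^sub>R y q - g 0 *\<^sub>R y 0 - (\<Sum>i<q. g (Suc i) *\<^sub>R (y (Suc i) - y i))"
  by (induction q) (simp_all add: algebra_simps)

lemma partitionsD:
  assumes "xs \<in> partitions a b"
  shows "xs \<noteq> []" "xs ! 0 = a" "xs ! (length xs - 1) = b"
    "i < j \<Longrightarrow> j < length xs \<Longrightarrow> xs ! i < xs ! j"
  using assms sorted_wrt_nth_less[of "(<)" xs i j]
  by (auto simp: partitions_def hd_conv_nth last_conv_nth)

lemma partitions_mono:
  assumes "xs \<in> partitions a b" "i \<le> j" "j < length xs"
  shows "xs ! i \<le> xs ! j"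
  using partitionsD(4)[OF assms(1), of i j] assms by (cases "i = j") auto

lemma partitions_bounds:
  assumes "xs \<in> partitions a b" "i < length xs"
  shows "xs ! i \<in> {a..b}"
  using partitions_mono[OF assms(1), of 0 i] partitions_mono[OF assms(1), of i "length xs - 1"]
    partitionsD[OF assms(1)] assms by auto

lemma partitions_length:
  assumes "xs \<in> partitions a b" "a < b"
  obtains q where "length xs = Suc (Suc q)"
  using partitionsD(1-3)[OF assms(1)] assms(2)
  by (cases xs; cases "tl xs") auto

lemma mesh_ge:
  assumes "i < length xs - 1"
  shows "xs ! Suc i - xs ! i \<le> mesh xs"
  unfolding mesh_def using assms by (intro Max_ge) auto

lemma mesh_pos:
  assumes "xs \<in> partitions a b" "a < b"
  shows "0 < mesh xs"
proof -
  obtain q where "length xs = Suc (Suc q)" using partitions_length[OF assms] .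
  then show ?thesis
    using mesh_ge[of 0 xs] partitionsD(4)[OF assms(1), of 0 1] by simp
qed

lemma partitions_locate:
  assumes "xs \<in> partitions a b" "a \<le> x" "x < b"
  obtains j where "j < length xs - 1" "xs ! j \<le> x" "x < xs ! Suc j"
proof -
  have "\<exists>k<length xs - 1. (\<forall>i\<le>k. \<not> x < xs ! i) \<and> x < xs ! Suc k"
    using partitionsD[OF assms(1)] assms(2,3)
    by (intro ex_least_nat_less[of "\<lambda>k. x < xs ! k"]) auto
  then obtain k where "k < length xs - 1" "\<not> x < xs ! k" "x < xs ! Suc k" by blast
  then show ?thesis using that[of k] by auto
qed

lemma partitions_sum_widths:
  assumes "xs \<in> partitions a b"
  shows "(\<Sum>i<length xs - 1. xs ! Suc i - xs ! i) = b - a"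
  using sum_lessThan_telescope[of "(!) xs" "length xs - 1"] partitionsD(2,3)[OF assms] by simp

text \<open>A chain can be made to pass through a prescribed point of F x only if x is a node, so
  fine partitions containing x are needed.\<close>

lemma partitions_through_point:
  fixes a x b :: real
  assumes "a < x" "x < b"
  obtains xs j where "xs \<in> partitions a b" "j < length xs - 1" "xs ! j = x"
    "mesh xs \<le> (b - a) / real (Suc m)"
proof -
  define k where "k = Suc m"
  have k: "k > 0" by (simp add: k_def)
  \<comment> \<open>There are \<open>k\<close> equal steps on [a, x] and \<open>k\<close> on [x, b],
    so x is the node with index \<open>k\<close>; both step lengths are at most (b - a) / k.\<close>
  define X where "X i = (if i \<le> k then a + real i * ((x - a) / real k)
      else x + (real i - real k) * ((b - x) / real k))" for i
  define xs where "xs = map X [0..<Suc (2 * k)]"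
  have len: "length xs = Suc (2 * k)" by (simp add: xs_def)
  have nth: "xs ! i = X i" if "i < Suc (2 * k)" for i
    unfolding xs_def using that by (simp del: upt_Suc)
  have step: "X (Suc i) - X i \<in> {(x - a) / real k, (b - x) / real k}" for i
  proof (cases "i < k")
    case False
    show ?thesis
    proof (cases "i = k")
      case True
      then show ?thesis using k by (simp add: X_def)
    qed (use False in \<open>simp add: X_def algebra_simps add_divide_distrib diff_divide_distrib\<close>)
  qed (simp add: X_def algebra_simps add_divide_distrib diff_divide_distrib)
  have "X i < X (Suc i)" for i
  proof -
    have "0 < (x - a) / real k" "0 < (b - x) / real k" using assms k by simp_all
    with step[of i] show ?thesis by auto
  qed
  then have mono: "X i < X j" if "i < j" for i j
    using that by (rule lift_Suc_mono_less)
  have "sorted_wrt (<) xs"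
    unfolding sorted_wrt_iff_nth_less len using nth mono by auto
  moreover have "xs \<noteq> []" using len by auto
  moreover have "hd xs = a" "last xs = b"
    using \<open>xs \<noteq> []\<close> k by (simp_all add: hd_conv_nth last_conv_nth len nth) (simp_all add: X_def)
  ultimately have "xs \<in> partitions a b" by (simp add: partitions_def)
  moreover have "k < length xs - 1" "xs ! k = x"
    using k by (auto simp: len nth X_def)
  moreover have "mesh xs \<le> (b - a) / real (Suc m)"
  proof -
    have "X (Suc i) - X i \<le> (b - a) / real k" for i
      using step[of i] assms k by (auto intro!: divide_right_mono)
    then show ?thesis
      unfolding mesh_def using k by (intro Max.boundedI) (auto simp: len nth lessThan_empty_iff k_def)
  qed
  ultimately show ?thesis using that by blast
qed

section \<open>Hausdorff distance and variation\<close>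

lemma ennreal_INF_add_right:
  fixes f :: "'a \<Rightarrow> ennreal"
  assumes "I \<noteq> {}"
  shows "(INF i\<in>I. f i + c) = (INF i\<in>I. f i) + c"
  using continuous_at_Inf_mono[of "\<lambda>x. x + c" "f ` I"] assms
  using continuous_add[of "at_right (Inf (f ` I))", of "\<lambda>x. x" "\<lambda>x. c"]
  by (auto simp: mono_def image_comp)

lemma ennreal_INF_add_left:
  fixes f :: "'a \<Rightarrow> ennreal"
  assumes "I \<noteq> {}"
  shows "(INF i\<in>I. c + f i) = c + (INF i\<in>I. f i)"
  using ennreal_INF_add_right[OF assms, of f c] by (simp add: ac_simps)

locale vector_norm =
  fixes N :: "real ^ 'd \<Rightarrow> real"
  assumes is_norm: "is_norm N"
begin

lemma N_simps [simp]: "0 \<le> N x" "N 0 = 0" "N (c *\<^sub>R x) = \<bar>c\<bar> * N x"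
  using is_norm by (auto simp: is_norm_def)

lemma N_triangle: "N (x + y) \<le> N x + N y"
  using is_norm by (auto simp: is_norm_def)

lemma N_uminus [simp]: "N (- x) = N x"
  using N_simps(3)[of "- 1" x] by simp

lemma N_commute: "N (x - y) = N (y - x)"
  using N_uminus[of "x - y"] by simp

lemma N_diff_triangle: "N (x - z) \<le> N (x - y) + N (y - z)"
  using N_triangle[of "x - y" "y - z"] by simp

lemma N_sum_scale: "N (\<Sum>i\<in>A. c i *\<^sub>R y i) \<le> (\<Sum>i\<in>A. \<bar>c i\<bar> * N (y i))"
proof (induction A rule: infinite_finite_induct)
  case (insert i A)
  then show ?case
    using N_triangle[of "c i *\<^sub>R y i" "\<Sum>i\<in>A. c i *\<^sub>R y i"] by simp
qed auto

text \<open>A norm is convex, and convex functions on a finite-dimensional space are continuous.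
  This ties \<open>N\<close> to the topology of the type, in which compactness and limits are
  taken.\<close>

lemma continuous_on_N: "continuous_on A N"
proof -
  have "convex_on UNIV N"
    by (rule convex_onI) (auto intro!: order_trans[OF N_triangle])
  then have "continuous_on UNIV N"
    by (intro convex_on_continuous) auto
  then show ?thesis by (rule continuous_on_subset) simp
qed

lemma tendsto_N_diff: "s \<longlonglongrightarrow> y \<Longrightarrow> (\<lambda>n. N (s n - y)) \<longlonglongrightarrow> 0"
  using continuous_on_tendsto_compose[OF continuous_on_N[of UNIV], of "\<lambda>n. s n - y" 0 sequentially]
  by (simp add: LIM_zero)

lemma dist_set_le: "b \<in> B \<Longrightarrow> dist_set N a B \<le> ennreal (N (a - b))"
  unfolding dist_set_def by (rule INF_lower)

lemma dist_set_le_haus: "a \<in> A \<Longrightarrow> dist_set N a B \<le> haus N A B"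
  "b \<in> B \<Longrightarrow> dist_set N b A \<le> haus N A B"
  unfolding haus_def by (auto intro: max.coboundedI1 max.coboundedI2 SUP_upper)

lemma haus_commute: "haus N A B = haus N B A"
  unfolding haus_def by (rule max.commute)

lemma haus_self [simp]: "haus N A A = 0"
proof -
  have "dist_set N a A = 0" if "a \<in> A" for a
    using dist_set_le[OF that, of a] by simp
  then show ?thesis by (cases "A = {}") (simp_all add: haus_def bot_ennreal)
qed

lemma dist_set_triangle: "dist_set N a C \<le> ennreal (N (a - b)) + dist_set N b C"
proof (cases "C = {}")
  case False
  have "dist_set N a C \<le> ennreal (N (a - b)) + ennreal (N (b - c))" if "c \<in> C" for c
  proof -
    have "dist_set N a C \<le> ennreal (N (a - c))" using that by (rule dist_set_le)
    also have "\<dots> \<le> ennreal (N (a - b) + N (b - c))"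
      by (intro ennreal_leI N_diff_triangle)
    finally show ?thesis by simp
  qed
  then have "dist_set N a C \<le> (INF c\<in>C. ennreal (N (a - b)) + ennreal (N (b - c)))"
    by (intro INF_greatest)
  also have "\<dots> = ennreal (N (a - b)) + dist_set N b C"
    unfolding dist_set_def using False by (simp add: ennreal_INF_add_left)
  finally show ?thesis .
qed (simp add: dist_set_def)

lemma haus_triangle:
  assumes "B \<noteq> {}"
  shows "haus N A C \<le> haus N A B + haus N B C"
proof -
  have *: "dist_set N a C \<le> haus N A B + haus N B C" if "a \<in> A" for a A C
  proof -
    have "dist_set N a C \<le> (INF b\<in>B. ennreal (N (a - b)) + haus N B C)"
      by (intro INF_greatest) (meson dist_set_triangle add_left_mono dist_set_le_haus(1) order_trans)
    also have "\<dots> = dist_set N a B + haus N B C"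
      unfolding dist_set_def using assms by (simp add: ennreal_INF_add_right)
    also have "\<dots> \<le> haus N A B + haus N B C"
      using that by (intro add_right_mono dist_set_le_haus)
    finally show ?thesis .
  qed
  show ?thesis
    unfolding haus_def[of N A C]
    using *[of _ A C] *[of _ C A] by (intro max.boundedI SUP_least) (auto simp: haus_commute add.commute)
qed

lemma metric_pairs_le_haus: "(a, b) \<in> metric_pairs N A B \<Longrightarrow> ennreal (N (a - b)) \<le> haus N A B"
  by (auto simp: metric_pairs_def dist_set_le_haus)

lemma nearest_point:
  assumes "compact A" "A \<noteq> {}"
  obtains a where "a \<in> A" "ennreal (N (b - a)) = dist_set N b A"
proof -
  have "continuous_on A (\<lambda>a. N (b - a))"
    by (rule continuous_on_compose2[OF continuous_on_N[of UNIV]]) (auto intro!: continuous_intros)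
  with continuous_attains_inf[OF assms] obtain a where a: "a \<in> A" "\<forall>c\<in>A. N (b - a) \<le> N (b - c)"
    by blast
  have "ennreal (N (b - a)) \<le> dist_set N b A"
    unfolding dist_set_def using a by (intro INF_greatest ennreal_leI) auto
  with dist_set_le[OF a(1), of b] have "ennreal (N (b - a)) = dist_set N b A" by (rule antisym[rotated])
  with a that show ?thesis by blast
qed

section \<open>Variation functions\<close>

lemma total_variation_superadditive:
  assumes "a \<le> s" "s < t"
  shows "total_variation N a s F + haus N (F s) (F t) \<le> total_variation N a t F"
proof -
  let ?S = "\<lambda>xs. \<Sum>i = 1..length xs - 1. haus N (F (xs ! i)) (F (xs ! (i - 1)))"
  \<comment> \<open>For a = s the partition is a single point. Nonemptiness is used to move the
    constant into the supremum at the end.\<close>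
  have "[a, s] \<in> partitions a s \<or> [a] \<in> partitions a s"
    using assms by (cases "a = s") (auto simp: partitions_def)
  then have ne: "partitions a s \<noteq> {}" by auto
  have "?S xs + haus N (F s) (F t) \<le> total_variation N a t F" if xs: "xs \<in> partitions a s" for xs
  proof -
    have "xs \<noteq> []" and last: "xs ! (length xs - 1) = s"
      using xs by (auto simp: partitions_def last_conv_nth)
    have mono: "x \<le> s" if x: "x \<in> set xs" for x
    proof -
      obtain i where "i < length xs" "x = xs ! i" using x by (auto simp: in_set_conv_nth)
      then show ?thesis
        using xs last sorted_wrt_nth_less[of "(<)" xs i "length xs - 1"]
        by (cases "i = length xs - 1") (auto simp: partitions_def intro!: less_imp_le)
    qed
    have mem: "xs @ [t] \<in> partitions a t"
      using xs assms mono by (force simp: partitions_def sorted_wrt_append)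
    obtain m where m: "length xs = Suc m" using \<open>xs \<noteq> []\<close> by (cases xs) auto
    have "?S (xs @ [t]) = (\<Sum>i = 1..Suc m. haus N (F ((xs @ [t]) ! i)) (F ((xs @ [t]) ! (i - 1))))"
      by (simp add: m)
    also have "\<dots> = (\<Sum>i = 1..m. haus N (F ((xs @ [t]) ! i)) (F ((xs @ [t]) ! (i - 1))))
        + haus N (F t) (F s)"
      using last by (simp add: m nth_append)
    also have "(\<Sum>i = 1..m. haus N (F ((xs @ [t]) ! i)) (F ((xs @ [t]) ! (i - 1)))) = ?S xs"
      by (intro sum.cong) (auto simp: m nth_append)
    finally have "?S xs + haus N (F s) (F t) = ?S (xs @ [t])"
      by (simp add: haus_commute)
    also have "\<dots> \<le> total_variation N a t F"
      unfolding total_variation_def using mem by (rule SUP_upper)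
    finally show ?thesis .
  qed
  then have "(SUP xs\<in>partitions a s. ?S xs + haus N (F s) (F t)) \<le> total_variation N a t F"
    by (intro SUP_least)
  then show ?thesis
    unfolding total_variation_def[of N a s F] using ne by (simp add: ennreal_SUP_add_left)
qed

lemma haus_continuous_atD:
  assumes "haus_continuous_at N S F x" "0 < e"
  shows "\<exists>\<delta>>0. \<forall>t\<in>S. \<bar>t - x\<bar> < \<delta> \<longrightarrow> haus N (F t) (F x) < ennreal e"
proof -
  have "0 < ennreal e" using assms(2) by simp
  with assms(1) have "eventually (\<lambda>t. haus N (F t) (F x) < ennreal e) (at x within S)"
    unfolding haus_continuous_at_def by (rule order_tendstoD(2))
  then obtain \<delta> where \<delta>: "\<delta> > 0"
    "\<And>t. t \<in> S \<Longrightarrow> t \<noteq> x \<Longrightarrow> dist t x < \<delta> \<Longrightarrow> haus N (F t) (F x) < ennreal e"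
    unfolding eventually_at by blast
  have "haus N (F t) (F x) < ennreal e" if "t \<in> S" "\<bar>t - x\<bar> < \<delta>" for t
    using \<delta>(2)[of t] that assms(2) by (cases "t = x") (auto simp: dist_real_def)
  with \<delta>(1) show ?thesis by blast
qed

text \<open>The witness is the variation of F over [a, t] as a function of t. Only monotonicity and
  the control of Hausdorff distances are recorded, so that another function with these two
  properties can replace it.\<close>

lemma variation_function:
  assumes "total_variation N a b F < \<infinity>"
  obtains v :: "real \<Rightarrow> real" where
    "\<And>s t. a \<le> s \<Longrightarrow> s \<le> t \<Longrightarrow> t \<le> b \<Longrightarrow> v s \<le> v t"
    "\<And>s t. a \<le> s \<Longrightarrow> s \<le> t \<Longrightarrow> t \<le> b \<Longrightarrow> haus N (F s) (F t) \<le> ennreal (v t - v s)"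
proof -
  let ?W = "\<lambda>t. total_variation N a t F"
  define v where "v t = enn2real (?W t)" for t
  have step: "?W s + haus N (F s) (F t) \<le> ?W t" if "a \<le> s" "s \<le> t" for s t
    using that total_variation_superadditive[of a s t F] by (cases "s = t") auto
  have W: "?W t = ennreal (v t)" if "a \<le> t" "t \<le> b" for t
  proof -
    have "?W t < \<infinity>"
      using step[OF that] assms by (auto simp: less_top[symmetric] top_unique)
    then show ?thesis by (simp add: v_def)
  qed
  have v: "v s \<le> v t" "haus N (F s) (F t) \<le> ennreal (v t - v s)"
    if st: "a \<le> s" "s \<le> t" "t \<le> b" for s t
  proof -
    have le: "ennreal (v s) + haus N (F s) (F t) \<le> ennreal (v t)"
      using step[OF st(1,2)] W[of s] W[of t] st by simp
    have "ennreal (v s) \<le> ennreal (v s) + haus N (F s) (F t)" by simp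
    with le have "ennreal (v s) \<le> ennreal (v t)" by (rule order_trans[rotated])
    then show mono: "v s \<le> v t" by (simp add: v_def)
    have "0 \<le> v s" by (simp add: v_def)
    with mono have "ennreal (v t) = ennreal (v s) + ennreal (v t - v s)"
      by (simp flip: ennreal_plus)
    with le show "haus N (F s) (F t) \<le> ennreal (v t - v s)"
      by (simp add: ennreal_add_left_cancel_le)
  qed
  show ?thesis using that[of v] v by blast
qed

text \<open>At a point of continuity of \<open>F\<close> the jump of a variation function can be removed without
  losing the control of the Hausdorff distances.\<close>

lemma continuous_variation_function:
  assumes "total_variation N a b F < \<infinity>" "\<And>x. x \<in> {a..b} \<Longrightarrow> F x \<noteq> {}"
    and x: "x \<in> {a<..<b}" and cont: "haus_continuous_at N {a..b} F x"
  shows "\<exists>v :: real \<Rightarrow> real.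
    (\<forall>s t. a \<le> s \<longrightarrow> s \<le> t \<longrightarrow> t \<le> b \<longrightarrow> v s \<le> v t \<and> haus N (F s) (F t) \<le> ennreal (v t - v s)) \<and>
    (\<forall>e>0. \<exists>\<alpha> \<beta>. a \<le> \<alpha> \<and> \<alpha> < x \<and> x < \<beta> \<and> \<beta> \<le> b \<and> v \<beta> - v \<alpha> < e)"
proof -
  obtain v :: "real \<Rightarrow> real" where
    vm: "\<And>s t. a \<le> s \<Longrightarrow> s \<le> t \<Longrightarrow> t \<le> b \<Longrightarrow> v s \<le> v t" and
    vh: "\<And>s t. a \<le> s \<Longrightarrow> s \<le> t \<Longrightarrow> t \<le> b \<Longrightarrow> haus N (F s) (F t) \<le> ennreal (v t - v s)"
    using variation_function[OF assms(1)] by blast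
  \<comment> \<open>\<open>L\<close> and \<open>R\<close> are the one-sided limits of the monotone
    function \<open>v\<close> at x.\<close>
  define L where "L = Sup (v ` {a..<x})"
  define R where "R = Inf (v ` {x<..b})"
  have bddL: "bdd_above (v ` {a..<x})" and bddR: "bdd_below (v ` {x<..b})"
    using x by (auto intro!: bdd_aboveI[of _ "v x"] bdd_belowI[of _ "v x"] vm)
  have neL: "v ` {a..<x} \<noteq> {}" and neR: "v ` {x<..b} \<noteq> {}" using x by auto
  have L: "v s \<le> L" if "a \<le> s" "s < x" for s
    unfolding L_def using that bddL by (intro cSup_upper) auto
  have R: "R \<le> v t" if "x < t" "t \<le> b" for t
    unfolding R_def using that bddR by (intro cInf_lower) auto
  have Lx: "L \<le> v x" unfolding L_def using x by (intro cSup_least[OF neL]) (auto intro!: vm)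
  have Rx: "v x \<le> R" unfolding R_def using x by (intro cInf_greatest[OF neR]) (auto intro!: vm)
  \<comment> \<open>Lowering the part right of x by the jump, and taking the left limit at x itself,
    makes the function continuous there.\<close>
  define w where "w t = (if t < x then v t else if t = x then L else v t - (R - L))" for t
  have wm: "w s \<le> w t" if "a \<le> s" "s \<le> t" "t \<le> b" for s t
    using that vm[of s t] L[of s] R[of t] unfolding w_def by auto
  \<comment> \<open>F x is reached through some t just below x: the way from s to t costs at most L
    - v s, and the remaining distance of F t and F x is arbitrarily small by continuity.\<close>
  have left: "haus N (F s) (F x) \<le> ennreal (w x - w s)" if s: "a \<le> s" "s < x" for s
  proof (rule ennreal_le_epsilon)
    fix e :: real assume e: "e > 0"
    obtain \<delta> where "\<delta> > 0" and \<delta>: "\<And>t. t \<in> {a..b} \<Longrightarrow> \<bar>t - x\<bar> < \<delta> \<Longrightarrow> haus N (F t) (F x) < ennreal e"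
      using haus_continuous_atD[OF cont e] by blast
    define t where "t = max s (x - \<delta> / 2)"
    have t: "s \<le> t" "t < x" "\<bar>t - x\<bar> < \<delta>" using s \<open>\<delta> > 0\<close> by (auto simp: t_def)
    have tx: "haus N (F t) (F x) \<le> ennreal e"
      using \<delta> t s x by (intro less_imp_le) auto
    have "haus N (F s) (F x) \<le> haus N (F s) (F t) + haus N (F t) (F x)"
      using t s x assms(2) by (intro haus_triangle) auto
    also have "\<dots> \<le> ennreal (v t - v s) + ennreal e"
      using t s x by (intro add_mono vh tx) auto
    also have "\<dots> \<le> ennreal (w x - w s) + ennreal e"
      using L[of t] t s by (intro add_right_mono ennreal_leI) (auto simp: w_def)
    finally show "haus N (F s) (F x) \<le> ennreal (w x - w s) + ennreal e" .
  qed
  have right: "haus N (F x) (F s) \<le> ennreal (w s - w x)" if s: "x < s" "s \<le> b" for s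
  proof (rule ennreal_le_epsilon)
    fix e :: real assume e: "e > 0"
    obtain \<delta> where "\<delta> > 0" and \<delta>: "\<And>t. t \<in> {a..b} \<Longrightarrow> \<bar>t - x\<bar> < \<delta> \<Longrightarrow> haus N (F t) (F x) < ennreal e"
      using haus_continuous_atD[OF cont e] by blast
    define t where "t = min s (x + \<delta> / 2)"
    have t: "t \<le> s" "x < t" "\<bar>t - x\<bar> < \<delta>" using s \<open>\<delta> > 0\<close> by (auto simp: t_def)
    have tx: "haus N (F x) (F t) \<le> ennreal e"
      using \<delta> t s x unfolding haus_commute[of "F x"] by (intro less_imp_le) auto
    have "haus N (F x) (F s) \<le> haus N (F x) (F t) + haus N (F t) (F s)"
      using t s x assms(2) by (intro haus_triangle) auto
    also have "\<dots> \<le> ennreal e + ennreal (v s - v t)"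
      using t s x by (intro add_mono vh tx) auto
    also have "\<dots> = ennreal (v s - v t) + ennreal e" by (rule add.commute)
    also have "\<dots> \<le> ennreal (w s - w x) + ennreal e"
      using R[of t] t s by (intro add_right_mono ennreal_leI) (auto simp: w_def)
    finally show "haus N (F x) (F s) \<le> ennreal (w s - w x) + ennreal e" .
  qed
  have wh: "haus N (F s) (F t) \<le> ennreal (w t - w s)" if st: "a \<le> s" "s \<le> t" "t \<le> b" for s t
  proof (cases "t < x \<or> x < s \<or> s = t")
    case True
    then show ?thesis using vh[OF st] st by (auto simp: w_def)
  next
    case False
    then consider "t = x" "s < x" | "s = x" "x < t" | "s < x" "x < t" using st by force
    then show ?thesis
    proof cases
      case 3
      have "haus N (F s) (F t) \<le> haus N (F s) (F x) + haus N (F x) (F t)"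
        using x assms(2) by (intro haus_triangle) auto
      also have "\<dots> \<le> ennreal (w x - w s) + ennreal (w t - w x)"
        using 3 st by (intro add_mono left right)
      also have "\<dots> = ennreal (w t - w s)"
        using wm[of s x] wm[of x t] 3 st by (simp flip: ennreal_plus)
      finally show ?thesis .
    qed (use left right st in auto)
  qed
  have wc: "\<exists>\<alpha> \<beta>. a \<le> \<alpha> \<and> \<alpha> < x \<and> x < \<beta> \<and> \<beta> \<le> b \<and> w \<beta> - w \<alpha> < e" if e: "e > 0" for e
  proof -
    have "L - e / 2 < Sup (v ` {a..<x})" using e by (simp add: L_def)
    then obtain \<alpha> where \<alpha>: "a \<le> \<alpha>" "\<alpha> < x" "L - e / 2 < v \<alpha>"
      unfolding less_cSup_iff[OF neL bddL] by auto
    have "Inf (v ` {x<..b}) < R + e / 2" using e by (simp add: R_def)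
    then obtain \<beta> where \<beta>: "x < \<beta>" "\<beta> \<le> b" "v \<beta> < R + e / 2"
      unfolding cInf_less_iff[OF neR bddR] by auto
    show ?thesis using \<alpha> \<beta> by (intro exI[of _ \<alpha>] exI[of _ \<beta>]) (auto simp: w_def)
  qed
  show ?thesis using wm wh wc by blast
qed

section \<open>Metric chains and Riemann sums\<close>

lemma metric_chainsD:
  assumes "ys \<in> metric_chains N (map F (butlast xs))"
  shows "length ys = length xs - 1"
    "i < length xs - 1 \<Longrightarrow> ys ! i \<in> F (xs ! i)"
    "Suc i < length xs - 1 \<Longrightarrow> ennreal (N (ys ! Suc i - ys ! i)) \<le> haus N (F (xs ! i)) (F (xs ! Suc i))"
proof -
  show "length ys = length xs - 1" "i < length xs - 1 \<Longrightarrow> ys ! i \<in> F (xs ! i)"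
    using assms by (auto simp: metric_chains_def nth_butlast)
  assume i: "Suc i < length xs - 1"
  then have "(ys ! i, ys ! Suc i) \<in> metric_pairs N (F (xs ! i)) (F (xs ! Suc i))"
    using assms by (auto simp: metric_chains_def nth_butlast)
  then show "ennreal (N (ys ! Suc i - ys ! i)) \<le> haus N (F (xs ! i)) (F (xs ! Suc i))"
    using metric_pairs_le_haus by (simp add: N_commute[of "ys ! Suc i"])
qed

section \<open>Construction of metric chains\<close>

lemma nearest_point_sequence:
  assumes "\<And>i. compact (A i)" "\<And>i. A i \<noteq> {}" "v \<in> A 0"
  obtains r where "r 0 = v" "\<And>i::nat. r i \<in> A i"
    "\<And>i. ennreal (N (r i - r (Suc i))) = dist_set N (r i) (A (Suc i))"
proof -
  have "\<exists>r. \<forall>i. (r i \<in> A i \<and> (i = 0 \<longrightarrow> r i = v)) \<and>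
      ennreal (N (r i - r (Suc i))) = dist_set N (r i) (A (Suc i))"
  proof (rule dependent_nat_choice)
    show "\<exists>y. y \<in> A 0 \<and> (0 = 0 \<longrightarrow> y = v)" using assms(3) by auto
    fix y i
    obtain z where "z \<in> A (Suc i)" "ennreal (N (y - z)) = dist_set N y (A (Suc i))"
      using nearest_point[OF assms(1,2)] .
    then show "\<exists>z. (z \<in> A (Suc i) \<and> (Suc i = 0 \<longrightarrow> z = v)) \<and>
        ennreal (N (y - z)) = dist_set N y (A (Suc i))" by auto
  qed
  then show ?thesis using that by blast
qed

text \<open>Repeated projection starting from v gives the points to the right, each nearest to its
  predecessor, and those to the left, each nearest to its successor. The two alternatives in
  \<open>metric_pairs\<close> admit these two directions.\<close>

lemma metric_chain_through_point:
  assumes "\<And>A. A \<in> set As \<Longrightarrow> compact A \<and> A \<noteq> {}" "j < length As" "v \<in> As ! j"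
  obtains ys where "ys \<in> metric_chains N As" "ys ! j = v"
proof -
  \<comment> \<open>Padding with \<open>As ! j\<close> makes the family infinite, so that projection
    never stops; the result is cut back to \<open>length As\<close> at the end.\<close>
  define A where "A i = (if i < length As then As ! i else As ! j)" for i
  have A: "compact (A i)" "A i \<noteq> {}" for i
    using assms(1)[of "A i"] assms(2) by (auto simp: A_def)
  have v: "v \<in> A (j + 0)" "v \<in> A (j - 0)" using assms(2,3) by (auto simp: A_def)
  obtain r where r: "r 0 = v" "\<And>i. r i \<in> A (j + i)"
    "\<And>i. ennreal (N (r i - r (Suc i))) = dist_set N (r i) (A (j + Suc i))"
    using nearest_point_sequence[of "\<lambda>i. A (j + i)" v] A v by blast
  \<comment> \<open>Subtraction on the naturals keeps this sequence in A 0 from step j on; only its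
    entries up to index j are used.\<close>
  obtain l where l: "l 0 = v" "\<And>i. l i \<in> A (j - i)"
    "\<And>i. ennreal (N (l i - l (Suc i))) = dist_set N (l i) (A (j - Suc i))"
    using nearest_point_sequence[of "\<lambda>i. A (j - i)" v] A v by blast
  define y where "y i = (if i < j then l (j - i) else r (i - j))" for i
  have yA: "y i \<in> A i" for i
    using l(2)[of "j - i"] r(2)[of "i - j"] by (auto simp: y_def)
  have "(y i, y (Suc i)) \<in> metric_pairs N (A i) (A (Suc i))" for i
  proof (cases "i < j")
    case True
    then have "y (Suc i) = l (j - Suc i)" "y i = l (Suc (j - Suc i))" "j - Suc (j - Suc i) = i"
      using l(1) r(1) by (auto simp: y_def Suc_diff_Suc)
    then have "ennreal (N (y i - y (Suc i))) = dist_set N (y (Suc i)) (A i)"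
      using l(3)[of "j - Suc i"] by (simp add: N_commute[of "l (Suc (j - Suc i))"])
    then show ?thesis using yA by (auto simp: metric_pairs_def)
  next
    case False
    then have "ennreal (N (y i - y (Suc i))) = dist_set N (y i) (A (Suc i))"
      using r(3)[of "i - j"] by (simp add: y_def Suc_diff_le)
    then show ?thesis using yA by (auto simp: metric_pairs_def)
  qed
  moreover have As: "As ! i = A i" if "i < length As" for i
    using that by (simp add: A_def)
  ultimately have "map y [0..<length As] \<in> metric_chains N As"
    using yA As unfolding metric_chains_def by force
  moreover have "map y [0..<length As] ! j = v"
    using assms(2) r(1) by (simp add: y_def)
  ultimately show ?thesis using that by blast
qed

text \<open>The three terms bound three errors: replacing the integral of the kernel over each
  interval by its value at the left node, the weighted increments of the chain at nodes at least
  \<delta> away from x, and those at nodes closer to x, where the weights are merely bounded but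
  only the variation over [\<alpha>, \<beta>] enters.\<close>

lemma riemann_sum_near_value:
  assumes mono: "\<And>s t. - pi \<le> s \<Longrightarrow> s \<le> t \<Longrightarrow> t \<le> pi \<Longrightarrow> v s \<le> v t"
    and control: "\<And>s t. - pi \<le> s \<Longrightarrow> s \<le> t \<Longrightarrow> t \<le> pi \<Longrightarrow> haus N (F s) (F t) \<le> ennreal (v t - v s)"
    and M: "\<And>t y. t \<in> {- pi..pi} \<Longrightarrow> y \<in> F t \<Longrightarrow> N y \<le> M"
    and \<delta>: "0 < \<delta>" "- pi \<le> \<alpha>" "\<alpha> + 2 * \<delta> \<le> x" "x \<le> \<beta> - 2 * \<delta>" "\<beta> \<le> pi"
    and xs: "xs \<in> partitions (- pi) pi" "mesh xs < \<delta>"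
    and ys: "ys \<in> metric_chains N (map F (butlast xs))"
    and j: "j < length xs - 1" "xs ! j \<le> x" "x < xs ! Suc j"
  shows "N ((\<Sum>i<length xs - 1. ((xs ! Suc i - xs ! i) * dirichlet_kernel n (x - xs ! i)) *\<^sub>R ys ! i)
      - pi *\<^sub>R ys ! j)
    \<le> mesh xs * ((\<Sum>k = 1..n. real k) * (2 * pi) * M)
      + 4 / ((2 * real n + 1) * sin (\<delta> / 2)) * (v pi - v (- pi)) + 20 * (v \<beta> - v \<alpha>)"
proof -
  have x: "x \<in> {- pi<..<pi}" "x \<in> {- pi + \<delta>..pi - \<delta>}" using \<delta> by auto
  obtain q where q: "length xs = Suc (Suc q)"
    using partitions_length[OF xs(1)] pi_gt_zero by auto
  define L where "L = (\<Sum>k = 1..n. real k)"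
  have "L \<ge> 0" by (simp add: L_def sum_nonneg)
  define X where "X = (!) xs"
  define Y where "Y = (!) ys"
  define g where "g i = step_error n x (X i)" for i
  define c where "c i = (X (Suc i) - X i) * dirichlet_kernel n (x - X i)" for i
  define r where "r i = c i - (dirichlet_primitive n (x - X i) - dirichlet_primitive n (x - X (Suc i)))" for i
  have X: "X i \<in> {- pi..pi}" if "i \<le> Suc q" for i
    unfolding X_def using partitions_bounds[OF xs(1)] that q by auto
  have Xm: "X i \<le> X k" if "i \<le> k" "k \<le> Suc q" for i k
    unfolding X_def using partitions_mono[OF xs(1)] that q by auto
  have Xd: "X (Suc i) - X i \<le> mesh xs" if "i \<le> q" for i
    unfolding X_def using mesh_ge[of i xs] that q by auto
  have jq: "j \<le> q" using j q by simp
  have NY: "0 \<le> N (Y i)" "N (Y i) \<le> M" if "i \<le> q" for i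
    using that M[OF X[of i]] metric_chainsD(2)[OF ys, of i] q by (auto simp: X_def Y_def)
  have g0: "g 0 = 0" "g (Suc q) = 0"
    using step_error_ends[OF x(1)] partitionsD(2,3)[OF xs(1)] q by (simp_all add: g_def X_def)
  \<comment> \<open>The differences of primitives are those of \<open>g\<close>, except on the
    interval containing x, where the step inside \<open>g\<close> jumps and \<pi> has to be
    restored.\<close>
  have decomp: "c i = (g (Suc i) - g i) + r i + (if i = j then pi else 0)" if "i \<le> q" for i
  proof -
    have "i < j \<Longrightarrow> X (Suc i) \<le> x" using Xm[of "Suc i" j] jq j by (simp add: X_def)
    moreover have "j < i \<Longrightarrow> x < X i" using Xm[of "Suc j" i] that j by (simp add: X_def)
    moreover have "X i \<le> X (Suc i)" using Xm that by simp
    ultimately show ?thesis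
      using j by (cases i j rule: linorder_cases) (auto simp: g_def r_def step_error_def X_def)
  qed
  have "(\<Sum>i<Suc q. c i *\<^sub>R Y i) - pi *\<^sub>R Y j
      = (\<Sum>i<Suc q. (g (Suc i) - g i) *\<^sub>R Y i) + (\<Sum>i<Suc q. r i *\<^sub>R Y i)"
  proof -
    have "(\<Sum>i<Suc q. c i *\<^sub>R Y i) = (\<Sum>i<Suc q. (g (Suc i) - g i) *\<^sub>R Y i + r i *\<^sub>R Y i
        + (if i = j then pi *\<^sub>R Y i else 0))"
      by (rule sum.cong) (auto simp: decomp algebra_simps)
    also have "\<dots> = (\<Sum>i<Suc q. (g (Suc i) - g i) *\<^sub>R Y i) + (\<Sum>i<Suc q. r i *\<^sub>R Y i) + pi *\<^sub>R Y j"
      using jq by (simp add: sum.distrib del: sum.lessThan_Suc)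
    finally show ?thesis by simp
  qed
  also have "(\<Sum>i<Suc q. (g (Suc i) - g i) *\<^sub>R Y i) = - (\<Sum>i<q. g (Suc i) *\<^sub>R (Y (Suc i) - Y i))"
    unfolding abel_summation g0 by simp
  finally have "N ((\<Sum>i<Suc q. c i *\<^sub>R Y i) - pi *\<^sub>R Y j)
      \<le> N (\<Sum>i<q. g (Suc i) *\<^sub>R (Y (Suc i) - Y i)) + N (\<Sum>i<Suc q. r i *\<^sub>R Y i)"
    using N_triangle[of "- (\<Sum>i<q. g (Suc i) *\<^sub>R (Y (Suc i) - Y i))"] by (simp only: N_uminus)
  also have "N (\<Sum>i<Suc q. r i *\<^sub>R Y i) \<le> mesh xs * (L * (2 * pi) * M)"
  proof -
    have "\<bar>r i\<bar> * N (Y i) \<le> (mesh xs * L * M) * (X (Suc i) - X i)" if "i < Suc q" for i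
    proof -
      have "\<bar>r i\<bar> \<le> L * (X (Suc i) - X i)\<^sup>2"
        using dirichlet_primitive_taylor[of n "x - X i" "x - X (Suc i)"]
        by (simp add: r_def c_def L_def abs_minus_commute)
      also have "\<dots> \<le> L * (mesh xs * (X (Suc i) - X i))"
        using Xd[of i] Xm[of i "Suc i"] that \<open>L \<ge> 0\<close> unfolding power2_eq_square
        by (intro mult_left_mono mult_right_mono) auto
      finally have "\<bar>r i\<bar> \<le> L * (mesh xs * (X (Suc i) - X i))" .
      then have "\<bar>r i\<bar> * N (Y i) \<le> L * (mesh xs * (X (Suc i) - X i)) * M"
        using NY[of i] that by (intro mult_mono) auto
      then show ?thesis by (simp add: mult_ac)
    qed
    then have "(\<Sum>i<Suc q. \<bar>r i\<bar> * N (Y i)) \<le> (\<Sum>i<Suc q. (mesh xs * L * M) * (X (Suc i) - X i))"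
      by (intro sum_mono) auto
    also have "\<dots> = (mesh xs * L * M) * (2 * pi)"
      unfolding sum_distrib_left[symmetric] X_def
      using partitions_sum_widths[OF xs(1)] q by simp
    finally show ?thesis
      using order_trans[OF N_sum_scale[of r Y "{..<Suc q}"]] by (simp add: mult_ac)
  qed
  also have "N (\<Sum>i<q. g (Suc i) *\<^sub>R (Y (Suc i) - Y i)) \<le>
      4 / ((2 * real n + 1) * sin (\<delta> / 2)) * (v pi - v (- pi)) + 20 * (v \<beta> - v \<alpha>)"
  proof -
    define K where "K = 4 / ((2 * real n + 1) * sin (\<delta> / 2))"
    have "K \<ge> 0" unfolding K_def using \<delta> by (intro divide_nonneg_nonneg mult_nonneg_nonneg sin_ge_zero) auto
    \<comment> \<open>This is \<open>v\<close> clamped to [\<alpha>, \<beta>]: its increments agree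
      with those of \<open>v\<close> near x, are nonnegative everywhere, and telescope to at most v
      \<beta> - v \<alpha>.\<close>
    define u where "u t = v (max \<alpha> (min \<beta> t))" for t
    have um: "u s \<le> u t" if "s \<le> t" for s t
      unfolding u_def using \<delta> that by (intro mono) auto
    have dY: "N (Y (Suc i) - Y i) \<le> v (X (Suc i)) - v (X i)" if "i < q" for i
    proof -
      have "ennreal (N (Y (Suc i) - Y i)) \<le> haus N (F (X i)) (F (X (Suc i)))"
        unfolding X_def Y_def using that q by (intro metric_chainsD(3)[OF ys]) auto
      also have "\<dots> \<le> ennreal (v (X (Suc i)) - v (X i))"
        using X[of i] X[of "Suc i"] Xm[of i "Suc i"] that by (intro control) auto
      finally show ?thesis
        using mono[of "X i" "X (Suc i)"] X[of i] X[of "Suc i"] Xm[of i "Suc i"] that by simp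
    qed
    have "\<bar>g (Suc i)\<bar> * N (Y (Suc i) - Y i)
        \<le> K * (v (X (Suc i)) - v (X i)) + 20 * (u (X (Suc i)) - u (X i))" if i: "i < q" for i
    proof -
      have dv: "0 \<le> v (X (Suc i)) - v (X i)"
        using dY[OF i] N_simps(1) by (rule order_trans[rotated])
      have du: "0 \<le> u (X (Suc i)) - u (X i)" using um Xm[of i "Suc i"] i by simp
      show ?thesis
      proof (cases "\<delta> \<le> \<bar>x - X (Suc i)\<bar>")
        case True
        have "\<bar>g (Suc i)\<bar> \<le> K"
          unfolding g_def K_def using True \<delta>(1) x(2) X[of "Suc i"] i by (intro abs_step_error_away) auto
        then have "\<bar>g (Suc i)\<bar> * N (Y (Suc i) - Y i) \<le> K * (v (X (Suc i)) - v (X i))"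
          using dY[OF i] \<open>K \<ge> 0\<close> by (intro mult_mono) auto
        with du show ?thesis by simp
      next
        \<comment> \<open>The mesh is below \<delta> and x lies at least 2 \<delta> inside
          [\<alpha>, \<beta>], so the preceding node is in [\<alpha>, \<beta>] as well.\<close>
        case False
        then have "X i \<in> {\<alpha>..\<beta>}" "X (Suc i) \<in> {\<alpha>..\<beta>}"
          using Xd[of i] Xm[of i "Suc i"] xs(2) i \<delta> by auto
        then have uv: "u (X (Suc i)) - u (X i) = v (X (Suc i)) - v (X i)"
          by (simp add: u_def)
        have "\<bar>g (Suc i)\<bar> \<le> 20"
          unfolding g_def using x(1) X[of "Suc i"] i by (intro abs_step_error_le) auto
        then have "\<bar>g (Suc i)\<bar> * N (Y (Suc i) - Y i) \<le> 20 * (v (X (Suc i)) - v (X i))"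
          using dY[OF i] by (intro mult_mono) auto
        with dv \<open>K \<ge> 0\<close> show ?thesis unfolding uv by (simp add: add_increasing)
      qed
    qed
    then have "(\<Sum>i<q. \<bar>g (Suc i)\<bar> * N (Y (Suc i) - Y i))
        \<le> (\<Sum>i<q. K * (v (X (Suc i)) - v (X i)) + 20 * (u (X (Suc i)) - u (X i)))"
      by (intro sum_mono) auto
    also have "\<dots> = K * (v (X q) - v (X 0)) + 20 * (u (X q) - u (X 0))"
      by (simp only: sum.distrib sum_distrib_left[symmetric]
          sum_lessThan_telescope[of "\<lambda>i. v (X i)"] sum_lessThan_telescope[of "\<lambda>i. u (X i)"])
    also have "\<dots> \<le> K * (v pi - v (- pi)) + 20 * (v \<beta> - v \<alpha>)"
      using \<open>K \<ge> 0\<close> X[of q] X[of 0] \<delta>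
      by (intro add_mono mult_left_mono diff_mono) (auto simp: u_def intro!: mono)
    finally show ?thesis
      unfolding K_def by (rule order_trans[OF N_sum_scale])
  qed
  finally show ?thesis
    using q by (simp add: c_def X_def Y_def L_def)
qed

section \<open>Convergence of the metric Fourier series\<close>

text \<open>A continuous function is bounded on the compact graph. This serves both for
  \<open>N\<close> and for the norm of the type.\<close>

lemma BV_compact_graph_bounded:
  fixes f :: "real ^ 'd \<Rightarrow> real"
  assumes "F \<in> BV_compact_graph N a b" "continuous_on UNIV f"
  shows "\<exists>M\<ge>0. \<forall>t\<in>{a..b}. \<forall>y\<in>F t. f y \<le> M"
proof -
  define G where "G = {(t, y). t \<in> {a..b} \<and> y \<in> F t}"
  have "compact ((\<lambda>p. f (snd p)) ` G)"
    using assms unfolding G_def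
    by (intro compact_continuous_image continuous_on_compose2[OF assms(2)] continuous_on_snd continuous_on_id)
       (auto simp: BV_compact_graph_def)
  then obtain M where M: "\<forall>z\<in>(\<lambda>p. f (snd p)) ` G. norm z \<le> M"
    using compact_imp_bounded bounded_iff by metis
  have "f y \<le> \<bar>M\<bar>" if "t \<in> {a..b}" "y \<in> F t" for t y
  proof -
    have "f y \<in> (\<lambda>p. f (snd p)) ` G" using that by (force simp: G_def)
    with M show ?thesis by force
  qed
  then show ?thesis by (intro exI[of _ "\<bar>M\<bar>"]) auto
qed

text \<open>Up to the factor \<pi>, a point of the series is a limit of Riemann sums. By
  \<open>est\<close> each fine sum is near \<pi> times the chain value at the last node not
  exceeding x, and continuity puts that value near F x. The size of \<open>C\<close> is irrelevant,
  as it is multiplied by a mesh tending to 0.\<close>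

lemma metric_fourier_subset_near:
  assumes y: "y \<in> metric_fourier N F n x" and x: "x \<in> {- pi<..<pi}"
    and cont: "haus_continuous_at N {- pi..pi} F x"
    and "0 < \<delta>"
    and est: "\<And>xs ys j. xs \<in> partitions (- pi) pi \<Longrightarrow> mesh xs < \<delta> \<Longrightarrow>
      ys \<in> metric_chains N (map F (butlast xs)) \<Longrightarrow>
      j < length xs - 1 \<Longrightarrow> xs ! j \<le> x \<Longrightarrow> x < xs ! Suc j \<Longrightarrow>
      N ((\<Sum>i<length xs - 1. ((xs ! Suc i - xs ! i) * dirichlet_kernel n (x - xs ! i)) *\<^sub>R ys ! i)
        - pi *\<^sub>R ys ! j) \<le> mesh xs * C + e"
    and "0 < e"
  shows "dist_set N y (F x) \<le> ennreal e"
proof (rule ennreal_le_epsilon)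
  \<comment> \<open>One third of \<open>d\<close> each is spent on the mesh term, on the distance of
    the sum from its limit, and on the distance of the set at the node from F x.\<close>
  fix d :: real assume "0 < d"
  obtain \<xi> s z where y: "y = (1 / pi) *\<^sub>R z" and \<xi>: "\<And>m. \<xi> m \<in> partitions (- pi) pi"
    and mesh: "(\<lambda>m. mesh (\<xi> m)) \<longlonglongrightarrow> 0"
    and s: "\<And>m. s m \<in> weighted_riemann_sum N (\<lambda>t. dirichlet_kernel n (x - t)) (\<xi> m) F" "s \<longlonglongrightarrow> z"
    using y unfolding metric_fourier_def weighted_metric_integral_def by blast
  obtain \<eta> where \<eta>: "0 < \<eta>"
    "\<And>t. t \<in> {- pi..pi} \<Longrightarrow> \<bar>t - x\<bar> < \<eta> \<Longrightarrow> haus N (F t) (F x) < ennreal (d / 3)"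
    using haus_continuous_atD[OF cont, of "d / 3"] \<open>0 < d\<close> by auto
  have "(\<lambda>m. mesh (\<xi> m) * C) \<longlonglongrightarrow> 0 * C" by (intro tendsto_intros mesh)
  then have "eventually (\<lambda>m. mesh (\<xi> m) * C < d / 3) sequentially"
    using \<open>0 < d\<close> by (intro order_tendstoD(2)) auto
  moreover have "eventually (\<lambda>m. mesh (\<xi> m) < min \<delta> \<eta>) sequentially"
    using mesh \<open>0 < \<delta>\<close> \<eta>(1) by (intro order_tendstoD(2)) auto
  moreover have "eventually (\<lambda>m. N (s m - z) < d / 3) sequentially"
    using tendsto_N_diff[OF s(2)] \<open>0 < d\<close> by (intro order_tendstoD(2)) auto
  ultimately have "eventually (\<lambda>m. mesh (\<xi> m) * C < d / 3 \<and> mesh (\<xi> m) < min \<delta> \<eta> \<and> N (s m - z) < d / 3)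
      sequentially"
    by eventually_elim auto
  then obtain m where m: "mesh (\<xi> m) * C < d / 3" "mesh (\<xi> m) < \<delta>" "mesh (\<xi> m) < \<eta>"
    "N (s m - z) < d / 3"
    by (auto simp: eventually_sequentially)
  obtain ys where ys: "ys \<in> metric_chains N (map F (butlast (\<xi> m)))"
    and sm: "s m = (\<Sum>i<length (\<xi> m) - 1. ((\<xi> m ! Suc i - \<xi> m ! i) * dirichlet_kernel n (x - \<xi> m ! i)) *\<^sub>R ys ! i)"
    using s(1)[of m] unfolding weighted_riemann_sum_def by blast
  obtain j where j: "j < length (\<xi> m) - 1" "\<xi> m ! j \<le> x" "x < \<xi> m ! Suc j"
    using partitions_locate[OF \<xi>, of x] x by auto
  have sj: "N (s m - pi *\<^sub>R ys ! j) \<le> mesh (\<xi> m) * C + e"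
    unfolding sm by (rule est[OF \<xi> m(2) ys j])
  have "N (y - ys ! j) \<le> N (pi *\<^sub>R (y - ys ! j))"
    using mult_right_mono[of 1 pi "N (y - ys ! j)"] pi_ge_two by simp
  also have "pi *\<^sub>R (y - ys ! j) = (z - s m) + (s m - pi *\<^sub>R ys ! j)"
    by (simp add: y algebra_simps)
  also have "N \<dots> \<le> N (s m - z) + N (s m - pi *\<^sub>R ys ! j)"
    using N_triangle[of "z - s m" "s m - pi *\<^sub>R ys ! j"] by (simp add: N_commute[of z "s m"])
  finally have near: "N (y - ys ! j) \<le> e + 2 * (d / 3)" using sj m by linarith
  have "\<xi> m ! j \<in> {- pi..pi}" using partitions_bounds[OF \<xi>] j by simp
  moreover have "\<bar>\<xi> m ! j - x\<bar> < \<eta>" using mesh_ge[OF j(1)] j m by auto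
  ultimately have "haus N (F (\<xi> m ! j)) (F x) \<le> ennreal (d / 3)"
    by (intro less_imp_le \<eta>(2))
  moreover have "dist_set N (ys ! j) (F x) \<le> haus N (F (\<xi> m ! j)) (F x)"
    by (intro dist_set_le_haus(1) metric_chainsD(2)[OF ys j(1)])
  ultimately have "dist_set N (ys ! j) (F x) \<le> ennreal (d / 3)" by (rule order_trans[rotated])
  with ennreal_leI[OF near]
  have "ennreal (N (y - ys ! j)) + dist_set N (ys ! j) (F x) \<le> ennreal (e + 2 * (d / 3)) + ennreal (d / 3)"
    by (rule add_mono)
  also have "\<dots> = ennreal e + ennreal d"
    using \<open>0 < d\<close> \<open>0 < e\<close> by (simp flip: ennreal_plus)
  finally show "dist_set N y (F x) \<le> ennreal e + ennreal d"
    by (rule order_trans[OF dist_set_triangle])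
qed

text \<open>Along partitions with node x and chains with value w there, the Riemann sums are bounded
  and hence have a convergent subsequence. Its limit divided by \<pi> belongs to the series and, by
  \<open>est\<close>, is within e of w.\<close>

lemma near_metric_fourier:
  assumes w: "w \<in> F x" and x: "x \<in> {- pi<..<pi}"
    and F: "F \<in> BV_compact_graph N (- pi) pi"
    and "0 < \<delta>"
    and est: "\<And>xs ys j. xs \<in> partitions (- pi) pi \<Longrightarrow> mesh xs < \<delta> \<Longrightarrow>
      ys \<in> metric_chains N (map F (butlast xs)) \<Longrightarrow>
      j < length xs - 1 \<Longrightarrow> xs ! j \<le> x \<Longrightarrow> x < xs ! Suc j \<Longrightarrow>
      N ((\<Sum>i<length xs - 1. ((xs ! Suc i - xs ! i) * dirichlet_kernel n (x - xs ! i)) *\<^sub>R ys ! i)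
        - pi *\<^sub>R ys ! j) \<le> mesh xs * C + e"
    and "0 < e"
  shows "dist_set N w (metric_fourier N F n x) \<le> ennreal e"
proof -
  let ?k = "\<lambda>t. dirichlet_kernel n (x - t)"
  \<comment> \<open>The bound is in the norm of the type, whose closed balls are known to be
    compact.\<close>
  obtain B where B: "0 \<le> B" "\<And>t y. t \<in> {- pi..pi} \<Longrightarrow> y \<in> F t \<Longrightarrow> norm y \<le> B"
    using BV_compact_graph_bounded[OF F continuous_on_norm_id] by blast
  have "\<exists>xs j. xs \<in> partitions (- pi) pi \<and> j < length xs - 1 \<and> xs ! j = x \<and>
      mesh xs \<le> (pi - - pi) / real (Suc m)" for m
    using partitions_through_point[of "- pi" x pi m] x by (metis greaterThanLessThan_iff)
  then obtain \<xi> J where \<xi>: "\<And>m. \<xi> m \<in> partitions (- pi) pi"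
    and J: "\<And>m. J m < length (\<xi> m) - 1" "\<And>m. \<xi> m ! J m = x"
    and mesh_le: "\<And>m. mesh (\<xi> m) \<le> (pi - - pi) / real (Suc m)"
    by metis
  have mesh: "(\<lambda>m. mesh (\<xi> m)) \<longlonglongrightarrow> 0"
  proof (rule tendsto_sandwich[where f = "\<lambda>_. 0"])
    show "(\<lambda>m. (pi - - pi) / real (Suc m)) \<longlonglongrightarrow> 0"
      by (rule LIMSEQ_Suc[OF lim_const_over_n])
    show "eventually (\<lambda>m. 0 \<le> mesh (\<xi> m)) sequentially"
      by (intro always_eventually allI less_imp_le mesh_pos[OF \<xi>]) auto
  qed (use mesh_le in auto)
  have "\<exists>ys. ys \<in> metric_chains N (map F (butlast (\<xi> m))) \<and> ys ! J m = w" for m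
  proof -
    have "compact A \<and> A \<noteq> {}" if "A \<in> set (map F (butlast (\<xi> m)))" for A
    proof -
      obtain t where "t \<in> set (\<xi> m)" "A = F t" using \<open>A \<in> _\<close> by (auto dest: in_set_butlastD)
      moreover from this have "t \<in> {- pi..pi}"
        using partitions_bounds[OF \<xi>, of _ m] by (metis in_set_conv_nth)
      ultimately show ?thesis using F by (auto simp: BV_compact_graph_def)
    qed
    moreover have "J m < length (map F (butlast (\<xi> m)))" "w \<in> map F (butlast (\<xi> m)) ! J m"
      using J[of m] w by (auto simp: nth_butlast)
    ultimately show ?thesis using metric_chain_through_point by metis
  qed
  then obtain ys where ys: "\<And>m. ys m \<in> metric_chains N (map F (butlast (\<xi> m)))" "\<And>m. ys m ! J m = w"
    by metis
  define s where "s m = (\<Sum>i<length (\<xi> m) - 1.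
      ((\<xi> m ! Suc i - \<xi> m ! i) * dirichlet_kernel n (x - \<xi> m ! i)) *\<^sub>R ys m ! i)" for m
  have s: "s m \<in> weighted_riemann_sum N ?k (\<xi> m) F" for m
    using ys(1)[of m] unfolding weighted_riemann_sum_def s_def by blast
  have "norm (s m) \<le> (real n + 1 / 2) * B * (2 * pi)" for m
  proof -
    have "norm (s m) \<le> (\<Sum>i<length (\<xi> m) - 1. ((real n + 1 / 2) * B) * (\<xi> m ! Suc i - \<xi> m ! i))"
      unfolding s_def
    proof (rule sum_norm_le)
      fix i assume "i \<in> {..<length (\<xi> m) - 1}"
      then have i: "i < length (\<xi> m) - 1" by simp
      have d: "0 \<le> \<xi> m ! Suc i - \<xi> m ! i" using partitions_mono[OF \<xi>, of i "Suc i" m] i by simp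
      have "norm (ys m ! i) \<le> B"
        using partitions_bounds[OF \<xi>, of i m] i by (intro B(2)[of "\<xi> m ! i"] metric_chainsD(2)[OF ys(1) i]) auto
      with d have "(\<xi> m ! Suc i - \<xi> m ! i) * \<bar>dirichlet_kernel n (x - \<xi> m ! i)\<bar> * norm (ys m ! i)
          \<le> (\<xi> m ! Suc i - \<xi> m ! i) * (real n + 1 / 2) * B"
        by (intro mult_mono mult_left_mono abs_dirichlet_kernel_le) auto
      with d show "norm (((\<xi> m ! Suc i - \<xi> m ! i) * dirichlet_kernel n (x - \<xi> m ! i)) *\<^sub>R ys m ! i)
          \<le> ((real n + 1 / 2) * B) * (\<xi> m ! Suc i - \<xi> m ! i)"
        by (simp add: abs_mult mult_ac)
    qed
    also have "\<dots> = (real n + 1 / 2) * B * (2 * pi)"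
      unfolding sum_distrib_left[symmetric] partitions_sum_widths[OF \<xi>] by simp
    finally show ?thesis .
  qed
  then have "\<forall>m. s m \<in> cball 0 ((real n + 1 / 2) * B * (2 * pi))" by simp
  then obtain z r where r: "strict_mono (r :: nat \<Rightarrow> nat)" and z: "(s \<circ> r) \<longlonglongrightarrow> z"
    using compact_cball[unfolded compact_def] by metis
  have "z \<in> weighted_metric_integral N ?k (- pi) pi F"
    unfolding weighted_metric_integral_def
    using \<xi> s z LIMSEQ_subseq_LIMSEQ[OF mesh r]
    by (auto simp: o_def intro!: exI[of _ "\<xi> \<circ> r"] exI[of _ "s \<circ> r"])
  then have mem: "(1 / pi) *\<^sub>R z \<in> metric_fourier N F n x"
    unfolding metric_fourier_def by (rule imageI)
  have "N (w - (1 / pi) *\<^sub>R z) \<le> e"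
  proof (rule field_le_epsilon)
    fix d :: real assume "0 < d"
    have mr: "(\<lambda>m. mesh (\<xi> (r m))) \<longlonglongrightarrow> 0"
      using LIMSEQ_subseq_LIMSEQ[OF mesh r] by (simp add: o_def)
    have "(\<lambda>m. mesh (\<xi> (r m)) * C) \<longlonglongrightarrow> 0 * C" by (intro tendsto_intros mr)
    then have "eventually (\<lambda>m. mesh (\<xi> (r m)) * C < d / 2) sequentially"
      using \<open>0 < d\<close> by (intro order_tendstoD(2)) auto
    moreover have "eventually (\<lambda>m. mesh (\<xi> (r m)) < \<delta>) sequentially"
      using mr \<open>0 < \<delta>\<close> by (intro order_tendstoD(2)) auto
    moreover have "eventually (\<lambda>m. N (s (r m) - z) < d / 2) sequentially"
      using tendsto_N_diff[OF z] \<open>0 < d\<close> by (intro order_tendstoD(2)) auto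
    ultimately have "eventually (\<lambda>m. mesh (\<xi> (r m)) * C < d / 2 \<and> mesh (\<xi> (r m)) < \<delta> \<and>
        N (s (r m) - z) < d / 2) sequentially"
      by eventually_elim auto
    then obtain m where m: "mesh (\<xi> (r m)) * C < d / 2" "mesh (\<xi> (r m)) < \<delta>" "N (s (r m) - z) < d / 2"
      by (auto simp: eventually_sequentially)
    have "x < \<xi> (r m) ! Suc (J (r m))"
      using partitionsD(4)[OF \<xi>, of "J (r m)" "Suc (J (r m))" "r m"] J[of "r m"] by simp
    then have "N (s (r m) - pi *\<^sub>R ys (r m) ! J (r m)) \<le> mesh (\<xi> (r m)) * C + e"
      unfolding s_def using J(2)[of "r m"] by (intro est[OF \<xi> m(2) ys(1) J(1)]) auto
    then have sw: "N (s (r m) - pi *\<^sub>R w) \<le> mesh (\<xi> (r m)) * C + e" by (simp only: ys(2))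
    have "N (w - (1 / pi) *\<^sub>R z) \<le> N (pi *\<^sub>R (w - (1 / pi) *\<^sub>R z))"
      using mult_right_mono[of 1 pi "N (w - (1 / pi) *\<^sub>R z)"] pi_ge_two by simp
    also have "pi *\<^sub>R (w - (1 / pi) *\<^sub>R z) = (s (r m) - z) + (pi *\<^sub>R w - s (r m))"
      by (simp add: algebra_simps)
    also have "N \<dots> \<le> N (s (r m) - z) + N (s (r m) - pi *\<^sub>R w)"
      using N_triangle[of "s (r m) - z" "pi *\<^sub>R w - s (r m)"] by (simp add: N_commute[of "pi *\<^sub>R w" "s (r m)"])
    finally show "N (w - (1 / pi) *\<^sub>R z) \<le> e + d" using sw m by linarith
  qed
  then show ?thesis
    by (intro order_trans[OF dist_set_le[OF mem]] ennreal_leI)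
qed

text \<open>The interval [\<alpha>, \<beta>], \<delta> and \<open>n0\<close> are chosen from x0 and
  e before x enters as an arbitrary nearby point of continuity.\<close>

lemma metric_fourier_locally_uniform:
  assumes F: "F \<in> BV_compact_graph N (- pi) pi" and x0: "x0 \<in> {- pi<..<pi}"
    and cont: "haus_continuous_at N {- pi..pi} F x0" and "0 < e"
  shows "\<exists>\<delta> n0. 0 < \<delta> \<and> (\<forall>n x. n0 \<le> n \<longrightarrow> \<bar>x - x0\<bar> < \<delta> \<longrightarrow>
    haus_continuous_at N {- pi..pi} F x \<longrightarrow> haus N (metric_fourier N F n x) (F x) < ennreal e)"
proof -
  have tv: "total_variation N (- pi) pi F < \<infinity>" and ne: "\<And>x. x \<in> {- pi..pi} \<Longrightarrow> F x \<noteq> {}"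
    using F by (auto simp: BV_compact_graph_def)
  obtain v :: "real \<Rightarrow> real" where
    mono: "\<And>s t. - pi \<le> s \<Longrightarrow> s \<le> t \<Longrightarrow> t \<le> pi \<Longrightarrow> v s \<le> v t" and
    control: "\<And>s t. - pi \<le> s \<Longrightarrow> s \<le> t \<Longrightarrow> t \<le> pi \<Longrightarrow> haus N (F s) (F t) \<le> ennreal (v t - v s)" and
    small: "\<And>e. 0 < e \<Longrightarrow> \<exists>\<alpha> \<beta>. - pi \<le> \<alpha> \<and> \<alpha> < x0 \<and> x0 < \<beta> \<and> \<beta> \<le> pi \<and> v \<beta> - v \<alpha> < e"
    using continuous_variation_function[OF tv ne x0 cont] by blast
  \<comment> \<open>The factor 20 turns e / 80 into e / 4. With another e / 4 for the kernel term
    this gives e / 2, which leaves room for the strict inequality.\<close>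
  obtain \<alpha> \<beta> where ab: "- pi \<le> \<alpha>" "\<alpha> < x0" "x0 < \<beta>" "\<beta> \<le> pi" "v \<beta> - v \<alpha> < e / 80"
    using small[of "e / 80"] \<open>0 < e\<close> by (meson divide_pos_pos zero_less_numeral)
  obtain M where M: "0 \<le> M" "\<And>t y. t \<in> {- pi..pi} \<Longrightarrow> y \<in> F t \<Longrightarrow> N y \<le> M"
    using BV_compact_graph_bounded[OF F continuous_on_N] by blast
  \<comment> \<open>A third is taken so that points within \<delta> of x0 still keep the distance 2
    \<delta> from \<alpha> and \<beta>.\<close>
  define \<delta> where "\<delta> = min (x0 - \<alpha>) (\<beta> - x0) / 3"
  have "0 < \<delta>" using ab by (simp add: \<delta>_def)
  have d3: "\<alpha> + 3 * \<delta> \<le> x0" "x0 + 3 * \<delta> \<le> \<beta>" by (auto simp: \<delta>_def)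
  have "sin (\<delta> / 2) > 0"
    using \<open>0 < \<delta>\<close> d3 ab x0 by (intro sin_gt_zero) auto
  have lim: "(\<lambda>n. 4 / ((2 * real n + 1) * sin (\<delta> / 2)) * (v pi - v (- pi))) \<longlonglongrightarrow> 0"
  proof -
    have "filterlim (\<lambda>n. real (2 * n + 1)) at_top sequentially"
      by (rule filterlim_compose[OF filterlim_real_sequentially])
         (rule filterlim_subseq, simp add: strict_mono_def)
    then have "(\<lambda>n. (4 / sin (\<delta> / 2) * (v pi - v (- pi))) / real (2 * n + 1)) \<longlonglongrightarrow> 0"
      by (intro tendsto_divide_0[OF tendsto_const] filterlim_at_top_imp_at_infinity)
    then show ?thesis by (simp add: field_simps)
  qed
  have "eventually (\<lambda>n. 4 / ((2 * real n + 1) * sin (\<delta> / 2)) * (v pi - v (- pi)) < e / 4) sequentially"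
    using \<open>0 < e\<close> by (intro order_tendstoD(2)[OF lim]) auto
  then obtain n0 where n0: "\<And>n. n0 \<le> n \<Longrightarrow>
      4 / ((2 * real n + 1) * sin (\<delta> / 2)) * (v pi - v (- pi)) < e / 4"
    unfolding eventually_sequentially by blast
  have "haus N (metric_fourier N F n x) (F x) < ennreal e"
    if n: "n0 \<le> n" and xd: "\<bar>x - x0\<bar> < \<delta>" and cx: "haus_continuous_at N {- pi..pi} F x" for n x
  proof -
    let ?C = "(\<Sum>k = 1..n. real k) * (2 * pi) * M"
    have x: "x \<in> {- pi<..<pi}" "\<alpha> + 2 * \<delta> \<le> x" "x \<le> \<beta> - 2 * \<delta>"
      using xd d3 ab \<open>0 < \<delta>\<close> by auto
    have est: "N ((\<Sum>i<length xs - 1. ((xs ! Suc i - xs ! i) * dirichlet_kernel n (x - xs ! i)) *\<^sub>R ys ! i)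
        - pi *\<^sub>R ys ! j) \<le> mesh xs * ?C + e / 2"
      if "xs \<in> partitions (- pi) pi" "mesh xs < \<delta>" "ys \<in> metric_chains N (map F (butlast xs))"
        "j < length xs - 1" "xs ! j \<le> x" "x < xs ! Suc j" for xs ys j
    proof -
      have "N ((\<Sum>i<length xs - 1. ((xs ! Suc i - xs ! i) * dirichlet_kernel n (x - xs ! i)) *\<^sub>R ys ! i)
          - pi *\<^sub>R ys ! j)
        \<le> mesh xs * ?C + 4 / ((2 * real n + 1) * sin (\<delta> / 2)) * (v pi - v (- pi)) + 20 * (v \<beta> - v \<alpha>)"
        by (rule riemann_sum_near_value[OF _ _ _ \<open>0 < \<delta>\<close> ab(1) x(2,3) ab(4) that])
           (rule mono control M(2); assumption)+
      moreover have "a \<le> c + e / 2" if "a \<le> c + k + 20 * d" "k < e / 4" "d < e / 80" for a c k d :: real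
        using that by linarith
      ultimately show ?thesis using n0[OF n] ab(5) by blast
    qed
    have "dist_set N y (F x) \<le> ennreal (e / 2)" if "y \<in> metric_fourier N F n x" for y
      using metric_fourier_subset_near[OF that x(1) cx \<open>0 < \<delta>\<close> est] \<open>0 < e\<close> by simp
    moreover have "dist_set N w (metric_fourier N F n x) \<le> ennreal (e / 2)" if "w \<in> F x" for w
      using near_metric_fourier[where C = ?C and e = "e / 2", OF that x(1) F \<open>0 < \<delta>\<close> est] \<open>0 < e\<close> by simp
    ultimately have "haus N (metric_fourier N F n x) (F x) \<le> ennreal (e / 2)"
      unfolding haus_def by (intro max.boundedI SUP_least)
    also have "\<dots> < ennreal e" using \<open>0 < e\<close> by (simp add: ennreal_less_iff)
    finally show ?thesis .
  qed
  with \<open>0 < \<delta>\<close> show ?thesis by blast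
qed

text \<open>The neighbourhoods of local uniformity cover I, and a finite subcover yields a common
  index.\<close>

lemma metric_fourier_uniform_on_compact:
  assumes F: "F \<in> BV_compact_graph N (- pi) pi" and I: "compact I" "I \<subseteq> {- pi<..<pi}"
    and cont: "\<And>x. x \<in> I \<Longrightarrow> haus_continuous_at N {- pi..pi} F x" and "0 < e"
  shows "\<exists>n0. \<forall>n\<ge>n0. \<forall>x\<in>I. haus N (metric_fourier N F n x) (F x) < ennreal e"
proof -
  have "\<exists>\<delta> n0. 0 < \<delta> \<and> (\<forall>n x. n0 \<le> n \<longrightarrow> \<bar>x - x0\<bar> < \<delta> \<longrightarrow>
      haus_continuous_at N {- pi..pi} F x \<longrightarrow> haus N (metric_fourier N F n x) (F x) < ennreal e)"
    if "x0 \<in> I" for x0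
    using that I(2) cont by (intro metric_fourier_locally_uniform F \<open>0 < e\<close>) auto
  then obtain \<delta> n0 where \<delta>: "\<And>x0. x0 \<in> I \<Longrightarrow> 0 < \<delta> x0"
    and n0: "\<And>x0 n x. x0 \<in> I \<Longrightarrow> n0 x0 \<le> n \<Longrightarrow> \<bar>x - x0\<bar> < \<delta> x0 \<Longrightarrow>
      haus_continuous_at N {- pi..pi} F x \<Longrightarrow> haus N (metric_fourier N F n x) (F x) < ennreal e"
    by metis
  have "I \<subseteq> (\<Union>x0\<in>I. ball x0 (\<delta> x0))" using \<delta> by auto
  then obtain J where J: "J \<subseteq> I" "finite J" "I \<subseteq> (\<Union>x0\<in>J. ball x0 (\<delta> x0))"
    using compactE_image[OF I(1), of I "\<lambda>x0. ball x0 (\<delta> x0)"] by auto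
  \<comment> \<open>The sum of the finitely many indices dominates each of them and makes sense for
    empty \<open>J\<close> too.\<close>
  have "haus N (metric_fourier N F n x) (F x) < ennreal e" if "n \<ge> (\<Sum>x0\<in>J. n0 x0)" "x \<in> I" for n x
  proof -
    obtain x0 where "x0 \<in> J" "x \<in> ball x0 (\<delta> x0)" using J(3) \<open>x \<in> I\<close> by blast
    moreover have "n0 x0 \<le> n"
      using member_le_sum[OF \<open>x0 \<in> J\<close>, of n0] J(2) that(1) by simp
    ultimately show ?thesis
      using n0[of x0 n x] J(1) cont[OF \<open>x \<in> I\<close>] by (auto simp: dist_real_def abs_minus_commute)
  qed
  then show ?thesis by blast
qed

end

theorem theorem6p19:
  fixes N :: "real ^ 'd \<Rightarrow> real" and F :: "real \<Rightarrow> (real ^ 'd) set"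
  assumes "is_norm N"
    and "F \<in> BV_compact_graph N (- pi) pi"
  shows "(\<forall>x\<in>{- pi<..<pi}. haus_continuous_at N {- pi..pi} F x \<longrightarrow>
            (\<lambda>n. haus N (metric_fourier N F n x) (F x)) \<longlonglongrightarrow> 0) \<and>
         (\<forall>c d. c \<le> d \<longrightarrow> {c..d} \<subseteq> {- pi<..<pi} \<longrightarrow>
            (\<forall>x\<in>{c..d}. haus_continuous_at N {- pi..pi} F x) \<longrightarrow>
            (\<forall>\<epsilon>>0. \<exists>n0. \<forall>n\<ge>n0. \<forall>x\<in>{c..d}.
               haus N (metric_fourier N F n x) (F x) < ennreal \<epsilon>))"
proof -
  interpret vector_norm N by unfold_locales (rule assms(1))
  have "(\<lambda>n. haus N (metric_fourier N F n x) (F x)) \<longlonglongrightarrow> 0"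
    if "x \<in> {- pi<..<pi}" "haus_continuous_at N {- pi..pi} F x" for x
  proof (rule order_tendstoI)
    fix a :: ennreal assume "0 < a"
    \<comment> \<open>\<open>a\<close> may be infinite, in which case e = 1 serves.\<close>
    then have "\<exists>e>0. ennreal e \<le> a" by (cases a) (auto intro: exI[of _ 1])
    then obtain e where e: "0 < e" "ennreal e \<le> a" by blast
    \<comment> \<open>Pointwise convergence is uniform convergence on the compact set {x}.\<close>
    have "\<exists>n0. \<forall>n\<ge>n0. \<forall>y\<in>{x}. haus N (metric_fourier N F n y) (F y) < ennreal e"
      using that e(1) by (intro metric_fourier_uniform_on_compact[OF assms(2)]) auto
    with e(2) show "eventually (\<lambda>n. haus N (metric_fourier N F n x) (F x) < a) sequentially"
      unfolding eventually_sequentially by (auto intro: less_le_trans)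
  qed auto
  moreover have "\<exists>n0. \<forall>n\<ge>n0. \<forall>x\<in>{c..d}. haus N (metric_fourier N F n x) (F x) < ennreal \<epsilon>"
    if "{c..d} \<subseteq> {- pi<..<pi}" "\<forall>x\<in>{c..d}. haus_continuous_at N {- pi..pi} F x" "\<epsilon> > 0" for c d \<epsilon>
    using that by (intro metric_fourier_uniform_on_compact[OF assms(2)]) auto
  ultimately show ?thesis by blast
qed

end
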